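(* The following statements are equivalent for every cardinal $\kappa$: (i) $\kappa$ is subtle. (ii) For all sufficiently large cardinals $\theta$, for every $\kappa$-list $\vec d=\langle d_\alpha\mid\alpha<\kappa\rangle$ and for every club $C$ in $\kappa$, there is a small embedding $j:M\longrightarrow \mathrm{H}(\theta)$ for $\kappa$ such that $\vec d,C\in\mathrm{ran}(j)$ and $d_\alpha=d_{\mathrm{crit}(j)}\cap\alpha$ for some $\alpha\in C\cap\mathrm{crit}(j)$.
   Context: $\mathrm{H}(\theta)$ is the set of all sets whose transitive closure has cardinality less than $\theta$. An elementary embedding $j:M\to N$ between transitive classes is non-trivial if there is an ordinal $\alpha\in M$ with $j(\alpha)>\alpha$; then $\mathrm{crit}(j)$ denotes the least such ordinal. Given cardinals $\kappa<\theta$, a non-trivial elementary embedding $j:M\to \mathrm{H}(\theta)$ is a small embedding for $\kappa$ if $M\in \mathrm{H}(\theta)$ is transitive and $j(\mathrm{crit}(j))=\kappa$. "For all sufficiently large cardinals $\theta$" means: there is an ordinal $\alpha\geq\kappa$ such that the statement holds for all cardinals $\theta>\alpha$. Given a set $A$, an $A$-list is a sequence $\langle d_a\mid a\in A\rangle$ with $d_a\subseteq a$ for all $a\in A$. An uncountable regular cardinal $\kappa$ is subtle if for every $\kappa$-list $\langle d_\alpha\mid\alpha<\kappa\rangle$ and every club $C$ in $\kappa$, there are $\alpha,\beta\in C$ with $\alpha<\beta$ and $d_\alpha=d_\beta\cap\alpha$. *)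

theory Defs
  imports Main "HOL-Library.FuncSet" "HOL-Library.Equipollence" "HOL-Library.Countable_Set"
begin

text \<open>
  The universe of sets is a type equipped with an extension map \<open>elts\<close> satisfying the axioms of ZFC.
  The schemes of separation and replacement are stated for arbitrary HOL predicates and functions.
  The axiom of choice is not listed because it follows from separation and the choice operator of HOL.
  Since every HOL function on the extension of a set is represented by a set (by replacement), functions
  between sets are rendered below as HOL functions on extensions, and classes as HOL sets.
\<close>

class zfc_universe =
  fixes elts :: "'a \<Rightarrow> 'a set"
  assumes extensionality: "elts x = elts y \<Longrightarrow> x = y"
    and foundation: "elts x \<noteq> {} \<Longrightarrow> \<exists>y\<in>elts x. elts y \<inter> elts x = {}"
    and pairing: "\<exists>z. elts z = {x, y}"
    and union: "\<exists>u. elts u = (\<Union>y\<in>elts x. elts y)"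
    and power_set: "\<exists>p. elts p = {y. elts y \<subseteq> elts x}"
    and infinity: "\<exists>w. (\<exists>e\<in>elts w. elts e = {}) \<and>
                       (\<forall>y\<in>elts w. \<exists>z\<in>elts w. elts z = insert y (elts y))"
    and separation: "\<exists>s. elts s = {y \<in> elts x. P y}"
    and replacement: "\<exists>r. elts r = f ` elts x"


text \<open>\<open>vset A\<close> is the set with extension \<open>A\<close>; it is meaningful only if there is such a set.\<close>

definition vset :: "'v::zfc_universe set \<Rightarrow> 'v" where
  "vset A = (THE x. elts x = A)"

definition vpair :: "'v::zfc_universe \<Rightarrow> 'v \<Rightarrow> 'v" where
  "vpair x y = vset {vset {x}, vset {x, y}}"

text \<open>The sequence \<open>\<langle>f a | a \<in> A\<rangle>\<close> as a set of Kuratowski pairs.\<close>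

definition vseq :: "'v::zfc_universe \<Rightarrow> ('v \<Rightarrow> 'v) \<Rightarrow> 'v" where
  "vseq A f = vset ((\<lambda>a. vpair a (f a)) ` elts A)"


definition transitive_set :: "'v::zfc_universe \<Rightarrow> bool" where
  "transitive_set x \<longleftrightarrow> (\<forall>y\<in>elts x. elts y \<subseteq> elts x)"

definition ordinal :: "'v::zfc_universe \<Rightarrow> bool" where
  "ordinal \<alpha> \<longleftrightarrow> transitive_set \<alpha> \<and> (\<forall>\<beta>\<in>elts \<alpha>. transitive_set \<beta>)"

definition cardinal :: "'v::zfc_universe \<Rightarrow> bool" where
  "cardinal \<kappa> \<longleftrightarrow> ordinal \<kappa> \<and> (\<forall>\<alpha>\<in>elts \<kappa>. \<not> elts \<alpha> \<approx> elts \<kappa>)"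

definition regular_cardinal :: "'v::zfc_universe \<Rightarrow> bool" where
  "regular_cardinal \<kappa> \<longleftrightarrow> cardinal \<kappa> \<and> infinite (elts \<kappa>) \<and>
     (\<forall>\<alpha>\<in>elts \<kappa>. \<forall>f \<in> elts \<alpha> \<rightarrow> elts \<kappa>. \<exists>\<beta>\<in>elts \<kappa>. f ` elts \<alpha> \<subseteq> elts \<beta>)"

definition transitive_closure :: "'v::zfc_universe \<Rightarrow> 'v set" where
  "transitive_closure x = {y. (y, x) \<in> {(u, v). u \<in> elts v}\<^sup>+}"

definition Hset :: "'v::zfc_universe \<Rightarrow> 'v set" where
  "Hset \<theta> = {x. transitive_closure x \<prec> elts \<theta>}"


text \<open>
  First-order formulas of the language of set theory, with variables named by natural numbers,
  and their satisfaction in the structure \<open>(M, \<in>)\<close>.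
\<close>

datatype fm = Mem nat nat | Eq nat nat | Neg fm | Conj fm fm | Exists nat fm

primrec sat :: "'v::zfc_universe set \<Rightarrow> fm \<Rightarrow> (nat \<Rightarrow> 'v) \<Rightarrow> bool" where
  "sat M (Mem m n) s \<longleftrightarrow> s m \<in> elts (s n)"
| "sat M (Eq m n) s \<longleftrightarrow> s m = s n"
| "sat M (Neg \<phi>) s \<longleftrightarrow> \<not> sat M \<phi> s"
| "sat M (Conj \<phi> \<psi>) s \<longleftrightarrow> sat M \<phi> s \<and> sat M \<psi> s"
| "sat M (Exists n \<phi>) s \<longleftrightarrow> (\<exists>x\<in>M. sat M \<phi> (s(n := x)))"

definition elementary_embedding :: "'v::zfc_universe set \<Rightarrow> 'v set \<Rightarrow> ('v \<Rightarrow> 'v) \<Rightarrow> bool" where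
  "elementary_embedding M N j \<longleftrightarrow> j \<in> M \<rightarrow> N \<and>
     (\<forall>\<phi>. \<forall>s. range s \<subseteq> M \<longrightarrow> (sat M \<phi> s \<longleftrightarrow> sat N \<phi> (j \<circ> s)))"

definition nontrivial_embedding :: "'v::zfc_universe set \<Rightarrow> ('v \<Rightarrow> 'v) \<Rightarrow> bool" where
  "nontrivial_embedding M j \<longleftrightarrow> (\<exists>\<alpha>\<in>M. ordinal \<alpha> \<and> \<alpha> \<in> elts (j \<alpha>))"

definition crit :: "'v::zfc_universe set \<Rightarrow> ('v \<Rightarrow> 'v) \<Rightarrow> 'v" where
  "crit M j = (THE \<alpha>. \<alpha> \<in> M \<and> ordinal \<alpha> \<and> \<alpha> \<in> elts (j \<alpha>) \<and>
     (\<forall>\<beta>\<in>M. ordinal \<beta> \<and> \<beta> \<in> elts (j \<beta>) \<longrightarrow> elts \<alpha> \<subseteq> elts \<beta>))"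

definition small_embedding ::
    "'v::zfc_universe \<Rightarrow> 'v \<Rightarrow> 'v \<Rightarrow> ('v \<Rightarrow> 'v) \<Rightarrow> bool" where
  "small_embedding \<kappa> \<theta> M j \<longleftrightarrow>
     M \<in> Hset \<theta> \<and> transitive_set M \<and>
     elementary_embedding (elts M) (Hset \<theta>) j \<and> nontrivial_embedding (elts M) j \<and>
     j (crit (elts M) j) = \<kappa>"


definition is_list :: "'v::zfc_universe \<Rightarrow> ('v \<Rightarrow> 'v) \<Rightarrow> bool" where
  "is_list A d \<longleftrightarrow> (\<forall>a\<in>elts A. elts (d a) \<subseteq> elts a)"

text \<open>
  Unboundedness is cofinality with respect to the non-strict order, so that every ordinal (also a
  successor) is a club in itself. In the closure clause, \<open>C\<close> strictly unbounded below \<open>\<beta>\<close>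
  forces the nonzero \<open>\<beta>\<close> to be a limit ordinal.
\<close>

definition club :: "'v::zfc_universe \<Rightarrow> 'v \<Rightarrow> bool" where
  "club C \<kappa> \<longleftrightarrow> elts C \<subseteq> elts \<kappa> \<and>
     (\<forall>\<alpha>\<in>elts \<kappa>. \<exists>\<gamma>\<in>elts C. elts \<alpha> \<subseteq> elts \<gamma>) \<and>
     (\<forall>\<beta>\<in>elts \<kappa>. elts \<beta> \<noteq> {} \<and> (\<forall>\<alpha>\<in>elts \<beta>. \<exists>\<gamma>\<in>elts C \<inter> elts \<beta>. \<alpha> \<in> elts \<gamma>)
        \<longrightarrow> \<beta> \<in> elts C)"

definition subtle :: "'v::zfc_universe \<Rightarrow> bool" where
  "subtle \<kappa> \<longleftrightarrow> uncountable (elts \<kappa>) \<and> regular_cardinal \<kappa> \<and>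
     (\<forall>d C. is_list \<kappa> d \<and> club C \<kappa> \<longrightarrow>
        (\<exists>\<alpha>\<in>elts C. \<exists>\<beta>\<in>elts C. \<alpha> \<in> elts \<beta> \<and> elts (d \<alpha>) = elts (d \<beta>) \<inter> elts \<alpha>))"

end

theory Submission imports Defs begin

text \<open>
  Suppose \<open>\<kappa>\<close> is subtle, and let \<open>d\<close>, \<open>C\<close> and a cardinal \<open>\<theta> > \<kappa>\<close> be given; the bound
  \<open>\<alpha>\<^sub>0 = \<kappa>\<close> already works. For \<open>\<beta> < \<kappa>\<close> let \<open>X \<beta>\<close> be the hull of
  \<open>\<beta> \<union> {d, C, \<kappa>}\<close> under countably many Skolem functions for \<open>H(\<theta>)\<close>. Since \<open>\<kappa>\<close> is regular and
  uncountable, the \<open>\<beta> \<in> C\<close> with \<open>X \<beta> \<inter> \<kappa> = \<beta>\<close> form a club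
  (\<open>club_hull_closure_points\<close>), so subtlety yields \<open>\<alpha> < \<beta>\<close> in it with
  \<open>d \<alpha> = d \<beta> \<inter> \<alpha>\<close>. The inverse of the Mostowski collapse of \<open>X \<beta>\<close> is an elementary embedding
  that fixes every ordinal below \<open>\<beta>\<close> and sends \<open>\<beta>\<close> to \<open>\<kappa>\<close>
  (\<open>small_embedding_of_elementary_substructure\<close>), and \<open>\<alpha>\<close> is the required element of
  \<open>C \<inter> crit j\<close>.

  Conversely, fix one cardinal \<open>\<theta> > \<alpha>\<^sub>0\<close>. If \<open>j : M \<rightarrow> H(\<theta>)\<close> is a small embedding for \<open>\<kappa>\<close> with
  critical point \<open>\<mu>\<close> and \<open>C\<close> is in its range, then \<open>C \<inter> \<mu>\<close> is the preimage of \<open>C\<close>, hence unbounded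
  in \<open>\<mu>\<close> by elementarity, and so \<open>\<mu> \<in> C\<close> (\<open>crit_mem_club\<close>). The hypothesis thus gives the
  combinatorial clause of subtlety with the witnesses \<open>\<alpha> < \<mu>\<close>. Regularity and
  uncountability follow from this clause: an infinite cardinal lacking one of them has a club \<open>C\<close> with an injective
  regressive function \<open>g\<close> (\<open>countable_regressive_club\<close>, \<open>singular_regressive_club\<close>), and the
  list \<open>d \<alpha> = {g \<alpha>}\<close> violates the clause on \<open>C\<close>. A finite \<open>\<kappa>\<close> is ruled out by a club with at
  most one element.
\<close>

section \<open>Small classes and membership\<close>

text \<open>Smallness of a class is what makes \<open>vset\<close> meaningful on it.\<close>

definition small :: "'v::zfc_universe set \<Rightarrow> bool" where
  "small A \<longleftrightarrow> (\<exists>x. elts x = A)"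

lemma small_elts [simp]: "small (elts x)"
  by (auto simp: small_def)

lemma elts_vset [simp]: "small A \<Longrightarrow> elts (vset A) = A"
  unfolding small_def vset_def by (metis (mono_tags, lifting) extensionality theI')

lemma small_subset: "small A \<Longrightarrow> B \<subseteq> A \<Longrightarrow> small B"
proof -
  assume "small A" "B \<subseteq> A"
  then obtain x where "elts x = A" by (auto simp: small_def)
  moreover obtain s where "elts s = {y \<in> elts x. y \<in> B}" using separation[of x "\<lambda>y. y \<in> B"] by blast
  ultimately show ?thesis using \<open>B \<subseteq> A\<close> unfolding small_def by (intro exI[of _ s]) auto
qed

lemma small_image:
  fixes f :: "'v::zfc_universe \<Rightarrow> 'v"
  shows "small A \<Longrightarrow> small (f ` A)"
  unfolding small_def using replacement[of f] by auto

lemma small_lepoll: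
  fixes x :: "'v::zfc_universe" and A :: "'v set"
  assumes "A \<lesssim> elts x" shows "small A"
proof -
  obtain g where "A \<subseteq> g ` elts x" using assms by (auto simp: lepoll_iff)
  then show ?thesis by (meson small_elts small_image small_subset)
qed

lemma small_pair [simp]: "small {x, y}"
  using pairing by (auto simp: small_def)

lemma small_singleton [simp]: "small {x}"
  using small_pair[of x x] by simp

lemma small_empty [simp]: "small {}"
  by (rule small_subset[OF small_singleton]) simp

lemma small_UN:
  fixes I :: "'v::zfc_universe set" and A :: "'v \<Rightarrow> 'v set"
  assumes "small I" "\<And>i. i \<in> I \<Longrightarrow> small (A i)" shows "small (\<Union>i\<in>I. A i)"
proof -
  define w where "w = vset ((\<lambda>i. vset (A i)) ` I)"
  have w: "elts w = (\<lambda>i. vset (A i)) ` I"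
    unfolding w_def using assms(1) by (intro elts_vset small_image)
  obtain u where "elts u = (\<Union>y\<in>elts w. elts y)" using union[of w] by blast
  then have "elts u = (\<Union>i\<in>I. A i)" using w assms(2) by simp
  then show ?thesis by (auto simp: small_def)
qed

lemma mem_not_refl: "x \<notin> elts x"
  using foundation[of "vset {x}"] by auto

text \<open>
  The iterated successors given by the axiom of infinity are pairwise distinct, since each belongs to all
  later ones. Such a set serves to index countable unions.
\<close>

lemma ex_infinite_set: "\<exists>w::'v::zfc_universe. infinite (elts w)"
proof -
  obtain w e :: 'v and S where e: "e \<in> elts w"
    and S: "\<And>y. y \<in> elts w \<Longrightarrow> S y \<in> elts w \<and> elts (S y) = insert y (elts y)"
    using infinity by metis
  define N where "N n = (S ^^ n) e" for n
  have N: "N n \<in> elts w" for n by (induction n) (auto simp: N_def e S)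
  have mem: "k < n \<Longrightarrow> N k \<in> elts (N n)" for k n
  proof (induction n)
    case (Suc n)
    have "elts (N (Suc n)) = insert (N n) (elts (N n))" using S[OF N[of n]] by (simp add: N_def)
    then show ?case using Suc by (auto simp: less_Suc_eq)
  qed simp
  have "inj N"
    by (rule linorder_injI) (metis mem mem_not_refl)
  then have "infinite (range N)" using finite_imageD by blast
  then show ?thesis using N by (meson finite_subset image_subsetI)
qed

lemma small_UN_nat:
  fixes A :: "nat \<Rightarrow> 'v::zfc_universe set"
  assumes "\<And>n. small (A n)" shows "small (\<Union>n. A n)"
proof -
  obtain w :: 'v where "infinite (elts w)" using ex_infinite_set by blast
  then obtain g :: "'v \<Rightarrow> nat" where "UNIV \<subseteq> g ` elts w"
    by (auto simp: infinite_le_lepoll lepoll_iff)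
  then have "g ` elts w = UNIV" by blast
  then have "(\<Union>n. A n) = (\<Union>i\<in>elts w. A (g i))" by (metis image_image)
  then show ?thesis using assms by (simp add: small_UN)
qed

lemma transitive_closure_subset:
  assumes "\<And>y. y \<in> T \<Longrightarrow> elts y \<subseteq> T" "elts x \<subseteq> T"
  shows "transitive_closure x \<subseteq> T"
proof
  fix y assume "y \<in> transitive_closure x"
  then have "(y, x) \<in> {(u, v). u \<in> elts v}\<^sup>+" by (simp add: transitive_closure_def)
  then show "y \<in> T"
    by (induction rule: converse_trancl_induct) (use assms in auto)
qed

lemma elts_subset_transitive_closure: "elts x \<subseteq> transitive_closure x"
  by (auto simp: transitive_closure_def)

lemma transitive_closure_mono: "y \<in> elts x \<Longrightarrow> transitive_closure y \<subseteq> transitive_closure x"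
  by (auto simp: transitive_closure_def intro: trancl_into_trancl)

text \<open>
  The transitive closure is the union of the sets obtained by iterating the union operation, and
  there are only countably many of them.
\<close>

lemma small_transitive_closure: "small (transitive_closure x)"
proof -
  define U where "U n = ((\<lambda>A. \<Union>y\<in>A. elts y) ^^ n) (elts x)" for n
  have "small (U n)" for n by (induction n) (auto simp: U_def intro: small_UN)
  then have sm: "small (\<Union>n. U n)" by (rule small_UN_nat)
  have "transitive_closure x \<subseteq> (\<Union>n. U n)"
  proof (rule transitive_closure_subset)
    fix y assume "y \<in> (\<Union>n. U n)"
    then obtain n where "y \<in> U n" by blast
    then have "elts y \<subseteq> U (Suc n)" by (auto simp: U_def)
    then show "elts y \<subseteq> (\<Union>n. U n)" by blast
  next
    show "elts x \<subseteq> (\<Union>n. U n)" by (metis U_def UN_upper funpow_0 UNIV_I)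
  qed
  then show ?thesis using sm small_subset by blast
qed

text \<open>
  The axiom of foundation speaks of sets only. A nonempty class \<open>Q\<close> containing \<open>x\<close> is cut down to a
  set by intersecting it with the transitive closure of \<open>x\<close>; if nothing
  remains, \<open>x\<close> itself is minimal.
\<close>

lemma wf_mem: "wf {(u, v). u \<in> elts (v::'v::zfc_universe)}"
proof (rule wfI_min)
  fix x :: 'v and Q assume "x \<in> Q"
  show "\<exists>z\<in>Q. \<forall>y. (y, z) \<in> {(u, v). u \<in> elts v} \<longrightarrow> y \<notin> Q"
  proof (cases "transitive_closure x \<inter> Q = {}")
    case True
    then show ?thesis using \<open>x \<in> Q\<close> elts_subset_transitive_closure[of x] by blast
  next
    case False
    define t where "t = vset (transitive_closure x \<inter> Q)"
    have t: "elts t = transitive_closure x \<inter> Q"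
      unfolding t_def by (intro elts_vset small_subset[OF small_transitive_closure]) blast
    then obtain z where z: "z \<in> elts t" "elts z \<inter> elts t = {}" using False foundation by metis
    have "elts z \<subseteq> transitive_closure x"
      using z(1) t elts_subset_transitive_closure
      by (auto simp: transitive_closure_def intro: trancl_into_trancl2)
    then show ?thesis using z t by blast
  qed
qed

lemmas mem_induct = wf_induct_rule[OF wf_mem, simplified, case_names mem]

lemma ex_mem_minimal:
  assumes "Q x" obtains z where "Q z" "\<And>y. y \<in> elts z \<Longrightarrow> \<not> Q y"
  using wfE_min[OF wf_mem, of x "Collect Q"] assms by auto

section \<open>Ordinals\<close>

lemma ordinal_elt: "ordinal \<alpha> \<Longrightarrow> \<beta> \<in> elts \<alpha> \<Longrightarrow> ordinal \<beta>"
  unfolding ordinal_def transitive_set_def by blast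

lemma ordinal_trans: "ordinal \<alpha> \<Longrightarrow> \<beta> \<in> elts \<alpha> \<Longrightarrow> \<gamma> \<in> elts \<beta> \<Longrightarrow> \<gamma> \<in> elts \<alpha>"
  unfolding ordinal_def transitive_set_def by blast

lemma ordinalI: "(\<And>\<beta>. \<beta> \<in> elts \<alpha> \<Longrightarrow> ordinal \<beta> \<and> elts \<beta> \<subseteq> elts \<alpha>) \<Longrightarrow> ordinal \<alpha>"
  unfolding ordinal_def transitive_set_def by blast

lemma ordinal_linear:
  assumes "ordinal \<alpha>" "ordinal \<beta>" shows "\<alpha> \<in> elts \<beta> \<or> \<alpha> = \<beta> \<or> \<beta> \<in> elts \<alpha>"
  using assms
proof (induction \<alpha> arbitrary: \<beta> rule: mem_induct)
  case (mem \<alpha>)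
  from mem.prems(2) show ?case
  proof (induction \<beta> rule: mem_induct)
    case inner: (mem \<beta>)
    have "elts \<alpha> = elts \<beta>" if "\<alpha> \<notin> elts \<beta>" "\<beta> \<notin> elts \<alpha>"
    proof (intro equalityI subsetI)
      fix x assume "x \<in> elts \<alpha>"
      then show "x \<in> elts \<beta>"
        using mem.IH[of x \<beta>] mem.prems(1) inner.prems that ordinal_elt ordinal_trans by metis
    next
      fix y assume "y \<in> elts \<beta>"
      then show "y \<in> elts \<alpha>"
        using inner.IH[of y] mem.prems(1) inner.prems that ordinal_elt ordinal_trans by metis
    qed
    then show ?case using extensionality by blast
  qed
qed

lemma ordinal_subset_iff:
  assumes "ordinal \<alpha>" "ordinal \<beta>" shows "elts \<alpha> \<subseteq> elts \<beta> \<longleftrightarrow> \<alpha> = \<beta> \<or> \<alpha> \<in> elts \<beta>"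
  using ordinal_linear[OF assms] ordinal_trans[OF assms(2)] mem_not_refl by blast

lemma ordinal_subset_linear:
  assumes "ordinal \<alpha>" "ordinal \<beta>" shows "elts \<alpha> \<subseteq> elts \<beta> \<or> \<beta> \<in> elts \<alpha>"
  using ordinal_linear[OF assms] ordinal_subset_iff[OF assms] by blast

lemma ordinal_mem_subset: "ordinal \<alpha> \<Longrightarrow> \<beta> \<in> elts \<alpha> \<Longrightarrow> elts \<beta> \<subseteq> elts \<alpha>"
  using ordinal_trans by blast

lemma ordinal_subset_mem:
  "ordinal \<alpha> \<Longrightarrow> ordinal \<gamma> \<Longrightarrow> elts \<alpha> \<subseteq> elts \<beta> \<Longrightarrow> \<beta> \<in> elts \<gamma> \<Longrightarrow> \<alpha> \<in> elts \<gamma>"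
  using ordinal_subset_iff[of \<alpha> \<beta>] ordinal_elt[of \<gamma> \<beta>] ordinal_trans[of \<gamma> \<beta> \<alpha>] by blast

text \<open>
  Ordinals are linearly ordered by inclusion, so finitely many of them have a maximum.
\<close>

lemma finite_subset_ordinal_bound:
  assumes "finite F" "F \<noteq> {}" "\<And>x. x \<in> F \<Longrightarrow> ordinal x"
  obtains m where "m \<in> F" "\<And>x. x \<in> F \<Longrightarrow> elts x \<subseteq> elts m"
proof -
  have "\<exists>m\<in>F. \<forall>x\<in>F. elts x \<subseteq> elts m"
    using assms
  proof (induction rule: finite_ne_induct)
    case (insert x F)
    then obtain m where m: "m \<in> F" "\<forall>x\<in>F. elts x \<subseteq> elts m" by auto
    then have "elts m \<subseteq> elts x \<or> elts x \<subseteq> elts m"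
      using ordinal_subset_linear[of m x] ordinal_subset_iff[of x m] insert.prems by auto
    then show ?case using m by auto
  qed simp
  then show ?thesis using that by blast
qed

section \<open>Mostowski collapse\<close>

definition collapse :: "('v::zfc_universe \<times> 'v) set \<Rightarrow> 'v \<Rightarrow> 'v" where
  "collapse R = wfrec R (\<lambda>f a. vset (f ` {b. (b, a) \<in> R}))"

text \<open>
  The collapse is applied to two kinds of relations: membership on an elementary substructure, to obtain a
  transitive model, and a well-order of a set, to obtain an ordinal of the same cardinality.
\<close>

locale small_wf_extensional =
  fixes X :: "'v::zfc_universe set" and R
  assumes small_X: "small X" and wf_R: "wf R" and R_sub: "R \<subseteq> X \<times> X"
    and ext: "\<And>a b. a \<in> X \<Longrightarrow> b \<in> X \<Longrightarrow> {c. (c, a) \<in> R} = {c. (c, b) \<in> R} \<Longrightarrow> a = b"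
begin

lemma elts_collapse: "elts (collapse R a) = collapse R ` {b. (b, a) \<in> R}"
proof -
  have "{b. (b, a) \<in> R} \<subseteq> X" using R_sub by auto
  then have sm: "small (collapse R ` {b. (b, a) \<in> R})"
    using small_X small_image small_subset by blast
  have "collapse R a = vset (cut (collapse R) R a ` {b. (b, a) \<in> R})"
    unfolding collapse_def by (subst wfrec[OF wf_R]) simp
  also have "cut (collapse R) R a ` {b. (b, a) \<in> R} = collapse R ` {b. (b, a) \<in> R}"
    by (rule image_cong) (auto simp: cut_def)
  finally show ?thesis using sm by simp
qed

lemma collapse_eqD: "a \<in> X \<Longrightarrow> b \<in> X \<Longrightarrow> collapse R a = collapse R b \<Longrightarrow> a = b"
proof (induction a arbitrary: b rule: wf_induct_rule[OF wf_R])
  case (1 a)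
  have eq: "collapse R ` {c. (c, a) \<in> R} = collapse R ` {c. (c, b) \<in> R}"
    using 1(4) elts_collapse by metis
  have "{c. (c, a) \<in> R} = {c. (c, b) \<in> R}"
  proof (intro equalityI subsetI; clarify)
    fix c assume c: "(c, a) \<in> R"
    then obtain c' where "(c', b) \<in> R" "collapse R c = collapse R c'" using eq by blast
    then show "(c, b) \<in> R" using 1(1)[OF c, of c'] c R_sub by auto
  next
    fix c assume c: "(c, b) \<in> R"
    then obtain c' where "(c', a) \<in> R" "collapse R c' = collapse R c" using eq by (metis (mono_tags, lifting) image_iff mem_Collect_eq)
    then show "(c, a) \<in> R" using 1(1)[of c' c] c R_sub by auto
  qed
  then show ?case using ext 1 by blast
qed

lemma inj_on_collapse: "inj_on (collapse R) X"
  using collapse_eqD by (auto simp: inj_on_def)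

lemma collapse_mem_iff:
  assumes "a \<in> X" "b \<in> X" shows "collapse R a \<in> elts (collapse R b) \<longleftrightarrow> (a, b) \<in> R"
  using assms elts_collapse[of b] collapse_eqD R_sub by auto

lemma elts_vset_collapse: "elts (vset (collapse R ` X)) = collapse R ` X"
  using elts_vset[OF small_image[OF small_X]] .

lemma transitive_collapse: "transitive_set (vset (collapse R ` X))"
  unfolding transitive_set_def elts_vset_collapse using elts_collapse R_sub by auto

end

section \<open>Cardinals\<close>

text \<open>
  The collapse of a well-order of \<open>x\<close> is transitive, and so are its elements since the
  order is transitive; hence it is an ordinal.
\<close>

lemma ex_ordinal_eqpoll:
  fixes x :: "'v::zfc_universe"
  shows "\<exists>\<gamma>::'v. ordinal \<gamma> \<and> elts \<gamma> \<approx> elts x"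
proof -
  obtain r where r: "well_order_on (elts x) r" using well_order_on by blast
  define R where "R = r - Id"
  have lin: "a \<in> elts x \<Longrightarrow> b \<in> elts x \<Longrightarrow> a \<noteq> b \<Longrightarrow> (a, b) \<in> R \<or> (b, a) \<in> R" for a b
    using r by (auto simp: well_order_on_def linear_order_on_def total_on_def R_def)
  have tr: "trans R" and wfR: "wf R" and sub: "R \<subseteq> elts x \<times> elts x"
    using r
    by (auto simp: well_order_on_def linear_order_on_def partial_order_on_def preorder_on_def
          R_def trans_diff_Id refl_on_def)
  interpret small_wf_extensional "elts x" R
  proof
    fix a b assume "a \<in> elts x" "b \<in> elts x" "{c. (c, a) \<in> R} = {c. (c, b) \<in> R}"
    then show "a = b" using lin[of a b] by (auto simp: R_def)
  qed (use wfR sub in auto)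
  have trans: "transitive_set (collapse R a)" for a
    unfolding transitive_set_def using elts_collapse tr by (auto dest: transD)
  have "ordinal (vset (collapse R ` elts x))"
    unfolding ordinal_def using trans transitive_collapse elts_vset_collapse by auto
  moreover have "elts (vset (collapse R ` elts x)) \<approx> elts x"
    unfolding elts_vset_collapse using inj_on_collapse inj_on_image_eqpoll_self by blast
  ultimately show ?thesis by blast
qed

text \<open>
  The least ordinal equipotent to the power set of \<open>\<alpha>\<close> is a cardinal, and by Cantor's theorem it is
  not contained in \<open>\<alpha>\<close>.
\<close>

lemma ex_cardinal_gt:
  assumes "ordinal (\<alpha>::'v::zfc_universe)"
  obtains \<theta> where "cardinal \<theta>" "\<alpha> \<in> elts \<theta>"
proof -
  obtain p where p: "elts p = {y. elts y \<subseteq> elts \<alpha>}" using power_set[of \<alpha>] by blast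
  have Pow: "Pow (elts \<alpha>) \<lesssim> elts p"
  proof -
    have "inj_on vset (Pow (elts \<alpha>))"
      by (rule inj_onI) (metis PowD elts_vset small_elts small_subset)
    moreover have "vset ` Pow (elts \<alpha>) \<subseteq> elts p"
      using p by (auto simp: elts_vset[OF small_subset[OF small_elts]])
    ultimately show ?thesis unfolding lepoll_def by blast
  qed
  obtain \<gamma> :: 'v where "ordinal \<gamma> \<and> elts \<gamma> \<approx> elts p" using ex_ordinal_eqpoll by blast
  then obtain \<theta> :: 'v where \<theta>: "ordinal \<theta>" "elts \<theta> \<approx> elts p"
    and least: "\<And>y. y \<in> elts \<theta> \<Longrightarrow> \<not> (ordinal y \<and> elts y \<approx> elts p)"
    using ex_mem_minimal[of "\<lambda>\<gamma>. ordinal \<gamma> \<and> elts \<gamma> \<approx> elts p"] by metis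
  have "cardinal \<theta>"
    unfolding cardinal_def using \<theta> least ordinal_elt eqpoll_trans by blast
  moreover have "\<not> elts \<theta> \<subseteq> elts \<alpha>"
  proof
    assume "elts \<theta> \<subseteq> elts \<alpha>"
    then have "Pow (elts \<alpha>) \<lesssim> elts \<alpha>"
      by (meson Pow \<theta>(2) eqpoll_sym lepoll_trans lepoll_trans2 subset_imp_lepoll)
    then show False by (meson lesspoll_Pow_self lesspoll_not_refl lesspoll_trans1)
  qed
  then have "\<alpha> \<in> elts \<theta>" using ordinal_subset_linear[OF \<theta>(1) assms] by blast
  ultimately show ?thesis using that by blast
qed

lemma cardinal_lesspoll:
  assumes "cardinal \<theta>" "\<kappa> \<in> elts \<theta>" shows "elts \<kappa> \<prec> elts \<theta>"
  using assms unfolding cardinal_def lesspoll_def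
  by (meson eqpoll_sym lepoll_def ordinal_trans subsetI subset_imp_lepoll inj_on_iff_surj)

text \<open>
  Otherwise \<open>\<kappa>\<close> is the successor of \<open>\<alpha>\<close>, and an infinite set is equipotent to its
  extension by one point.
\<close>

lemma infinite_cardinal_limit:
  assumes "cardinal \<kappa>" "infinite (elts \<kappa>)" "\<alpha> \<in> elts \<kappa>"
  obtains \<beta> where "\<beta> \<in> elts \<kappa>" "\<alpha> \<in> elts \<beta>"
proof (rule ccontr)
  assume "\<not> thesis"
  then have no: "\<And>\<beta>. \<beta> \<in> elts \<kappa> \<Longrightarrow> \<alpha> \<notin> elts \<beta>" using that by blast
  have ord: "ordinal \<kappa>" using assms by (simp add: cardinal_def)
  have "elts \<kappa> = insert \<alpha> (elts \<alpha>)"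
    using no ordinal_linear ordinal_elt[OF ord] ordinal_trans[OF ord] assms(3) by blast
  then have "elts \<alpha> \<approx> elts \<kappa>"
    using assms(2) infinite_insert_eqpoll eqpoll_sym by (metis finite_insert)
  then show False using assms by (auto simp: cardinal_def)
qed

lemma infinite_cardinal_join:
  assumes \<kappa>: "cardinal \<kappa>" "infinite (elts \<kappa>)" and "\<alpha> \<in> elts \<kappa>" "\<beta> \<in> elts \<kappa>"
  obtains \<gamma> where "\<gamma> \<in> elts \<kappa>" "\<alpha> \<in> elts \<gamma>" "\<beta> \<in> elts \<gamma>"
proof -
  have ord: "ordinal \<kappa>" using \<kappa> by (simp add: cardinal_def)
  have oa: "ordinal \<alpha>" and ob: "ordinal \<beta>" using assms ordinal_elt[OF ord] by blast+
  obtain \<mu> where \<mu>: "\<mu> \<in> elts \<kappa>" "elts \<alpha> \<subseteq> elts \<mu>" "elts \<beta> \<subseteq> elts \<mu>"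
  proof (cases "elts \<alpha> \<subseteq> elts \<beta>")
    case True
    then show ?thesis using that[of \<beta>] assms by blast
  next
    case False
    then have "elts \<beta> \<subseteq> elts \<alpha>" using ordinal_subset_linear[OF oa ob] ordinal_mem_subset[OF oa] by blast
    then show ?thesis using that[of \<alpha>] assms by blast
  qed
  obtain \<gamma> where \<gamma>: "\<gamma> \<in> elts \<kappa>" "\<mu> \<in> elts \<gamma>"
    using infinite_cardinal_limit[OF \<kappa> \<mu>(1)] by blast
  have "ordinal \<gamma>" using \<gamma> ordinal_elt[OF ord] by blast
  then show ?thesis using that[of \<gamma>] \<gamma> \<mu> oa ob ordinal_subset_mem by blast
qed

text \<open>
  If all elements of \<open>\<kappa>\<close> were finite, they would be determined by their cardinalities, natural
  numbers, and \<open>\<kappa>\<close> would be countable.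
\<close>

lemma uncountable_ordinal_infinite_elt:
  assumes ord: "ordinal \<kappa>" and unc: "uncountable (elts \<kappa>)"
  obtains \<gamma> where "\<gamma> \<in> elts \<kappa>" "infinite (elts \<gamma>)"
proof (rule ccontr)
  assume "\<not> thesis"
  then have fin: "\<And>\<gamma>. \<gamma> \<in> elts \<kappa> \<Longrightarrow> finite (elts \<gamma>)" using that by blast
  have "inj_on (\<lambda>\<gamma>. card (elts \<gamma>)) (elts \<kappa>)"
  proof (rule inj_onI)
    fix \<alpha> \<beta> assume *: "\<alpha> \<in> elts \<kappa>" "\<beta> \<in> elts \<kappa>" "card (elts \<alpha>) = card (elts \<beta>)"
    then have "ordinal \<alpha>" "ordinal \<beta>" using ordinal_elt[OF ord] by blast+
    then have "elts \<alpha> \<subseteq> elts \<beta> \<or> elts \<beta> \<subseteq> elts \<alpha>"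
      using ordinal_subset_linear[of \<alpha> \<beta>] ordinal_mem_subset[of \<alpha> \<beta>] by blast
    then have "elts \<alpha> = elts \<beta>"
      using card_subset_eq[OF fin[OF *(1)], of "elts \<beta>"] card_subset_eq[OF fin[OF *(2)], of "elts \<alpha>"] *(3)
      by auto
    then show "\<alpha> = \<beta>" by (rule extensionality)
  qed
  then show False using unc unfolding countable_def by blast
qed

lemma regular_cardinal_bound:
  assumes reg: "regular_cardinal \<kappa>" and \<gamma>: "\<gamma> \<in> elts \<kappa>"
    and S: "S \<subseteq> elts \<kappa>" "S \<lesssim> elts \<gamma>"
  shows "\<exists>\<beta>\<in>elts \<kappa>. S \<subseteq> elts \<beta>"
proof -
  obtain g where g: "S \<subseteq> g ` elts \<gamma>" using S(2) unfolding lepoll_iff by blast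
  define f where "f x = (if g x \<in> S then g x else \<gamma>)" for x
  have "f \<in> elts \<gamma> \<rightarrow> elts \<kappa>" using S(1) \<gamma> by (auto simp: f_def)
  then obtain \<beta> where \<beta>: "\<beta> \<in> elts \<kappa>" "f ` elts \<gamma> \<subseteq> elts \<beta>"
    using reg \<gamma> unfolding regular_cardinal_def by blast
  have "S \<subseteq> f ` elts \<gamma>"
  proof
    fix y assume "y \<in> S"
    then obtain x where "x \<in> elts \<gamma>" "y = g x" using g by blast
    then show "y \<in> f ` elts \<gamma>" using \<open>y \<in> S\<close> by (intro image_eqI[of _ _ x]) (simp_all add: f_def)
  qed
  then show ?thesis using \<beta> by blast
qed

lemma infinite_Times_lepoll:
  assumes "infinite K" "A \<lesssim> K" "B \<lesssim> K" shows "A \<times> B \<lesssim> K"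
proof -
  have "K \<times> K \<approx> K"
    unfolding eqpoll_iff_card_of_ordIso using assms(1) by (rule card_of_Times_same_infinite)
  then show ?thesis using times_lepoll_mono[OF assms(2,3)] lepoll_trans2 by blast
qed

lemma infinite_UN_lepoll:
  assumes "infinite K" "I \<lesssim> K" "\<And>i. i \<in> I \<Longrightarrow> A i \<lesssim> K" shows "(\<Union>i\<in>I. A i) \<lesssim> K"
proof -
  obtain g where g: "\<And>i. i \<in> I \<Longrightarrow> A i \<subseteq> g i ` K"
    using assms(3) unfolding lepoll_iff by metis
  have "(\<Union>i\<in>I. A i) \<subseteq> (\<lambda>(i, k). g i k) ` (I \<times> K)" using g by fastforce
  then have "(\<Union>i\<in>I. A i) \<lesssim> I \<times> K" by (rule subset_image_lepoll)
  then show ?thesis using infinite_Times_lepoll[OF assms(1,2) lepoll_refl] lepoll_trans by blast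
qed

lemma infinite_Un_lepoll:
  assumes "infinite K" "A \<lesssim> K" "B \<lesssim> K" shows "A \<union> B \<lesssim> K"
proof -
  have "(\<Union>i\<in>UNIV. if i then A else B) \<lesssim> K"
    using assms by (intro infinite_UN_lepoll) (auto simp: finite_lepoll_infinite)
  moreover have "(\<Union>i\<in>UNIV. if i then A else B) = A \<union> B" by (auto split: if_splits)
  ultimately show ?thesis by simp
qed

lemma infinite_lists_lepoll:
  assumes K: "infinite K" and A: "A \<lesssim> K" shows "lists A \<lesssim> K"
proof -
  have "{l \<in> lists A. length l = n} \<lesssim> K" for n
  proof (induction n)
    case 0
    have "{l \<in> lists A. length l = 0} = {[]}" by auto
    then show ?case using K by (simp add: finite_lepoll_infinite)
  next
    case (Suc n)
    have "{l \<in> lists A. length l = Suc n} \<subseteq> (\<lambda>(a, l). a # l) ` (A \<times> {l \<in> lists A. length l = n})"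
    proof
      fix l assume "l \<in> {l \<in> lists A. length l = Suc n}"
      then obtain a m where "l = a # m" "a \<in> A" "m \<in> lists A" "length m = n" by (cases l) auto
      then show "l \<in> (\<lambda>(a, l). a # l) ` (A \<times> {l \<in> lists A. length l = n})"
        by (intro image_eqI[of _ _ "(a, m)"]) auto
    qed
    then show ?case
      by (rule lepoll_trans[OF subset_image_lepoll infinite_Times_lepoll[OF K A Suc]])
  qed
  moreover have "(UNIV::nat set) \<lesssim> K" using K infinite_le_lepoll by blast
  ultimately have "(\<Union>n. {l \<in> lists A. length l = n}) \<lesssim> K" by (intro infinite_UN_lepoll K)
  moreover have "(\<Union>n. {l \<in> lists A. length l = n}) = lists A" by auto
  ultimately show ?thesis by simp
qed

section \<open>Clubs carrying an injective regressive function\<close>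

text \<open>
  A finite ordinal is empty or has a maximum, whose singleton is a club.
\<close>

lemma finite_ordinal_club:
  assumes \<kappa>: "ordinal \<kappa>" and fin: "finite (elts \<kappa>)"
  shows "\<exists>C. club C \<kappa> \<and> (\<forall>\<alpha>\<in>elts C. \<forall>\<beta>\<in>elts \<kappa>. \<alpha> \<notin> elts \<beta>)"
proof (cases "elts \<kappa> = {}")
  case True
  then have "club \<kappa> \<kappa>" by (simp add: club_def)
  then show ?thesis using True by blast
next
  case False
  then obtain m where m: "m \<in> elts \<kappa>" "\<And>x. x \<in> elts \<kappa> \<Longrightarrow> elts x \<subseteq> elts m"
    using finite_subset_ordinal_bound[OF fin] ordinal_elt[OF \<kappa>] by blast
  have "club (vset {m}) \<kappa>" unfolding club_def using m mem_not_refl by auto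
  moreover have "m \<notin> elts \<beta>" if "\<beta> \<in> elts \<kappa>" for \<beta> using m(2)[OF that] mem_not_refl by blast
  ultimately show ?thesis by (intro exI[of _ "vset {m}"]) simp
qed

text \<open>
  All elements of such a \<open>\<kappa>\<close> are finite, for otherwise one of them would be equipotent to
  \<open>\<kappa>\<close>. Hence the nonzero elements form a club consisting of successors, and the predecessor function
  is regressive and injective.
\<close>

lemma countable_regressive_club:
  assumes \<kappa>: "cardinal \<kappa>" and inf: "infinite (elts \<kappa>)" and count: "countable (elts \<kappa>)"
  shows "\<exists>C g. club C \<kappa> \<and> (\<forall>\<alpha>\<in>elts C. g \<alpha> \<in> elts \<alpha>) \<and> inj_on g (elts C)"
proof -
  have ord: "ordinal \<kappa>" using \<kappa> by (simp add: cardinal_def)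
  have fin: "finite (elts \<alpha>)" if \<alpha>: "\<alpha> \<in> elts \<kappa>" for \<alpha>
  proof (rule ccontr)
    assume "infinite (elts \<alpha>)"
    then have "(UNIV :: nat set) \<lesssim> elts \<alpha>" by (simp add: infinite_le_lepoll)
    moreover have "elts \<kappa> \<lesssim> (UNIV :: nat set)"
      using count unfolding countable_def lepoll_def by blast
    ultimately have "elts \<kappa> \<lesssim> elts \<alpha>" using lepoll_trans by blast
    then have "elts \<alpha> \<approx> elts \<kappa>"
      using lepoll_antisym subset_imp_lepoll[OF ordinal_mem_subset[OF ord \<alpha>]] by blast
    then show False using \<kappa> \<alpha> by (simp add: cardinal_def)
  qed
  define C where "C = vset {\<alpha> \<in> elts \<kappa>. elts \<alpha> \<noteq> {}}"
  have C: "elts C = {\<alpha> \<in> elts \<kappa>. elts \<alpha> \<noteq> {}}"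
    unfolding C_def by (rule elts_vset, rule small_subset[OF small_elts[of \<kappa>]]) blast
  have "\<exists>m\<in>elts \<alpha>. elts \<alpha> = insert m (elts m)" if \<alpha>: "\<alpha> \<in> elts C" for \<alpha>
  proof -
    have o\<alpha>: "ordinal \<alpha>" using \<alpha> C ordinal_elt[OF ord] by blast
    obtain m where m: "m \<in> elts \<alpha>" "\<And>x. x \<in> elts \<alpha> \<Longrightarrow> elts x \<subseteq> elts m"
      using finite_subset_ordinal_bound[of "elts \<alpha>"] fin \<alpha> C ordinal_elt[OF o\<alpha>] by auto
    have "x = m \<or> x \<in> elts m" if "x \<in> elts \<alpha>" for x
      using m(2)[OF that] ordinal_subset_iff[OF ordinal_elt[OF o\<alpha> that] ordinal_elt[OF o\<alpha> m(1)]]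
      by blast
    then have "elts \<alpha> = insert m (elts m)" using m(1) ordinal_mem_subset[OF o\<alpha>] by blast
    then show ?thesis using m by blast
  qed
  then obtain g where g: "\<And>\<alpha>. \<alpha> \<in> elts C \<Longrightarrow> g \<alpha> \<in> elts \<alpha> \<and> elts \<alpha> = insert (g \<alpha>) (elts (g \<alpha>))"
    by metis
  have "inj_on g (elts C)"
    by (rule inj_onI) (metis g extensionality)
  moreover have "club C \<kappa>"
    unfolding club_def C
  proof (intro conjI ballI impI)
    fix \<alpha> assume "\<alpha> \<in> elts \<kappa>"
    then obtain \<beta> where \<beta>: "\<beta> \<in> elts \<kappa>" "\<alpha> \<in> elts \<beta>" using infinite_cardinal_limit[OF \<kappa> inf] by blast
    then have "elts \<alpha> \<subseteq> elts \<beta>" using ordinal_mem_subset ordinal_elt[OF ord] by blast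
    then show "\<exists>\<gamma>\<in>{\<alpha> \<in> elts \<kappa>. elts \<alpha> \<noteq> {}}. elts \<alpha> \<subseteq> elts \<gamma>" using \<beta> by blast
  qed blast+
  ultimately show ?thesis using g by blast
qed

text \<open>
  Let \<open>\<nu> < \<kappa>\<close> be least with an unbounded map \<open>f\<close> from \<open>\<nu>\<close> to \<open>\<kappa>\<close>. The partial
  suprema \<open>h \<xi> = sup ({\<nu>} \<union> {f \<eta> + 1 | \<eta> < \<xi>})\<close> lie below \<open>\<kappa>\<close> by the minimality of \<open>\<nu>\<close>, and
  they form a club because \<open>h\<close> is monotone, continuous and unbounded. Choosing for each value a \<open>\<xi> < \<nu>\<close>
  at which it is attained is an injection, and it is regressive because every value is at least \<open>\<nu>\<close>.
\<close>

lemma singular_regressive_club: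
  assumes \<kappa>: "cardinal \<kappa>" and inf: "infinite (elts \<kappa>)" and nreg: "\<not> regular_cardinal \<kappa>"
  shows "\<exists>C g. club C \<kappa> \<and> (\<forall>\<alpha>\<in>elts C. g \<alpha> \<in> elts \<alpha>) \<and> inj_on g (elts C)"
proof -
  have ord: "ordinal \<kappa>" using \<kappa> by (simp add: cardinal_def)
  define Q where "Q = (\<lambda>\<alpha>. \<alpha> \<in> elts \<kappa> \<and> (\<exists>f \<in> elts \<alpha> \<rightarrow> elts \<kappa>. \<forall>\<beta>\<in>elts \<kappa>. \<not> f ` elts \<alpha> \<subseteq> elts \<beta>))"
  have "\<exists>\<alpha>. Q \<alpha>" using nreg \<kappa> inf unfolding regular_cardinal_def Q_def by blast
  then obtain \<nu> where "Q \<nu>" and least: "\<And>\<xi>. \<xi> \<in> elts \<nu> \<Longrightarrow> \<not> Q \<xi>"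
    using ex_mem_minimal[of Q] by blast
  then obtain f where \<nu>: "\<nu> \<in> elts \<kappa>" and f: "f \<in> elts \<nu> \<rightarrow> elts \<kappa>"
    and unb: "\<And>\<beta>. \<beta> \<in> elts \<kappa> \<Longrightarrow> \<not> f ` elts \<nu> \<subseteq> elts \<beta>"
    unfolding Q_def by blast
  have o\<nu>: "ordinal \<nu>" using ordinal_elt[OF ord \<nu>] .
  have bound: "\<exists>\<beta>\<in>elts \<kappa>. f ` elts \<xi> \<subseteq> elts \<beta>" if \<xi>: "\<xi> \<in> elts \<nu>" for \<xi>
  proof -
    have "elts \<xi> \<subseteq> elts \<nu>" using ordinal_mem_subset[OF o\<nu> \<xi>] .
    then have "f \<in> elts \<xi> \<rightarrow> elts \<kappa>" using f by blast
    moreover have "\<xi> \<in> elts \<kappa>" using ordinal_trans[OF ord \<nu> \<xi>] .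
    ultimately show ?thesis using least[OF \<xi>] unfolding Q_def by blast
  qed
  have of: "ordinal (f \<xi>)" if "\<xi> \<in> elts \<nu>" for \<xi> using f that ordinal_elt[OF ord] by blast
  \<comment> \<open>If \<open>\<nu>\<close> were a successor, deleting its last point would leave an unbounded map on a smaller ordinal.\<close>
  have limit: "\<exists>\<xi>\<in>elts \<nu>. \<eta> \<in> elts \<xi>" if \<eta>: "\<eta> \<in> elts \<nu>" for \<eta>
  proof (rule ccontr)
    assume "\<not> ?thesis"
    then have sub: "elts \<nu> \<subseteq> insert \<eta> (elts \<eta>)"
      using ordinal_linear[OF _ ordinal_elt[OF o\<nu> \<eta>]] ordinal_elt[OF o\<nu>] by blast
    obtain \<beta> where \<beta>: "\<beta> \<in> elts \<kappa>" "f ` elts \<eta> \<subseteq> elts \<beta>" using bound[OF \<eta>] by blast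
    obtain \<gamma> where \<gamma>: "\<gamma> \<in> elts \<kappa>" "\<beta> \<in> elts \<gamma>" "f \<eta> \<in> elts \<gamma>"
      using infinite_cardinal_join[OF \<kappa> inf \<beta>(1), of "f \<eta>"] f \<eta> by blast
    have "elts \<beta> \<subseteq> elts \<gamma>" using ordinal_mem_subset[OF ordinal_elt[OF ord \<gamma>(1)] \<gamma>(2)] .
    then have "f ` elts \<nu> \<subseteq> elts \<gamma>" using sub \<beta>(2) \<gamma>(3) by blast
    then show False using unb \<gamma>(1) by blast
  qed
  define h where "h \<xi> = vset (elts \<nu> \<union> (\<Union>\<eta>\<in>elts \<xi>. insert (f \<eta>) (elts (f \<eta>))))" for \<xi>
  have h: "elts (h \<xi>) = elts \<nu> \<union> (\<Union>\<eta>\<in>elts \<xi>. insert (f \<eta>) (elts (f \<eta>)))"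
    if \<xi>: "\<xi> \<in> elts \<nu>" for \<xi>
  proof -
    have "elts \<nu> \<union> (\<Union>\<eta>\<in>elts \<xi>. insert (f \<eta>) (elts (f \<eta>))) \<subseteq> elts \<kappa>"
      using ordinal_mem_subset[OF ord \<nu>] f ordinal_mem_subset[OF ord] ordinal_mem_subset[OF o\<nu> \<xi>]
      by blast
    then show ?thesis unfolding h_def by (intro elts_vset small_subset[OF small_elts])
  qed
  have oh: "ordinal (h \<xi>)" if \<xi>: "\<xi> \<in> elts \<nu>" for \<xi>
  proof (rule ordinalI)
    fix \<beta> assume "\<beta> \<in> elts (h \<xi>)"
    then consider "\<beta> \<in> elts \<nu>" | \<eta> where "\<eta> \<in> elts \<xi>" "\<beta> = f \<eta> \<or> \<beta> \<in> elts (f \<eta>)"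
      using h[OF \<xi>] by blast
    then show "ordinal \<beta> \<and> elts \<beta> \<subseteq> elts (h \<xi>)"
    proof cases
      case 1
      then show ?thesis using h[OF \<xi>] ordinal_elt[OF o\<nu>] ordinal_mem_subset[OF o\<nu>] by blast
    next
      case 2
      have "ordinal (f \<eta>)" using of ordinal_trans[OF o\<nu> \<xi> 2(1)] .
      then have "ordinal \<beta> \<and> elts \<beta> \<subseteq> elts (f \<eta>)"
        using 2 ordinal_elt ordinal_mem_subset by blast
      then show ?thesis using h[OF \<xi>] 2(1) by blast
    qed
  qed
  have h\<kappa>: "h \<xi> \<in> elts \<kappa>" if \<xi>: "\<xi> \<in> elts \<nu>" for \<xi>
  proof -
    obtain \<beta> where \<beta>: "\<beta> \<in> elts \<kappa>" "f ` elts \<xi> \<subseteq> elts \<beta>" using bound[OF \<xi>] by blast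
    obtain \<gamma> where \<gamma>: "\<gamma> \<in> elts \<kappa>" "\<beta> \<in> elts \<gamma>" "\<nu> \<in> elts \<gamma>"
      using infinite_cardinal_join[OF \<kappa> inf \<beta>(1) \<nu>] by blast
    have o\<gamma>: "ordinal \<gamma>" using ordinal_elt[OF ord \<gamma>(1)] .
    have "elts \<beta> \<subseteq> elts \<gamma>" "elts \<nu> \<subseteq> elts \<gamma>" using ordinal_mem_subset[OF o\<gamma>] \<gamma> by blast+
    then have "elts (h \<xi>) \<subseteq> elts \<gamma>"
      unfolding h[OF \<xi>] using \<beta>(2) ordinal_mem_subset[OF o\<gamma>] by blast
    then show ?thesis using ordinal_subset_mem[OF oh[OF \<xi>] ord _ \<gamma>(1)] by blast
  qed
  have h_mono: "elts (h \<xi>) \<subseteq> elts (h \<zeta>)" if "\<xi> \<in> elts \<nu>" "\<zeta> \<in> elts \<nu>" "elts \<xi> \<subseteq> elts \<zeta>" for \<xi> \<zeta>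
    using that unfolding h[OF that(1)] h[OF that(2)] by blast
  define C where "C = vset (h ` elts \<nu>)"
  have C: "elts C = h ` elts \<nu>" unfolding C_def by (intro elts_vset small_image small_elts)
  have "club C \<kappa>"
    unfolding club_def C
  proof (intro conjI ballI impI)
    show "h ` elts \<nu> \<subseteq> elts \<kappa>" using h\<kappa> by blast
  next
    fix \<alpha> assume \<alpha>: "\<alpha> \<in> elts \<kappa>"
    then obtain \<eta> where \<eta>: "\<eta> \<in> elts \<nu>" "f \<eta> \<notin> elts \<alpha>" using unb[OF \<alpha>] by blast
    obtain \<xi> where \<xi>: "\<xi> \<in> elts \<nu>" "\<eta> \<in> elts \<xi>" using limit[OF \<eta>(1)] by blast
    have "elts \<alpha> \<subseteq> elts (f \<eta>)"
      using ordinal_subset_linear[OF ordinal_elt[OF ord \<alpha>] of[OF \<eta>(1)]] \<eta>(2) by blast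
    also have "\<dots> \<subseteq> elts (h \<xi>)" using h[OF \<xi>(1)] \<xi>(2) by blast
    finally show "\<exists>\<gamma>\<in>h ` elts \<nu>. elts \<alpha> \<subseteq> elts \<gamma>" using \<xi>(1) by blast
  next
    fix \<beta> assume \<beta>: "\<beta> \<in> elts \<kappa>"
      and "elts \<beta> \<noteq> {} \<and> (\<forall>\<alpha>\<in>elts \<beta>. \<exists>\<gamma>\<in>h ` elts \<nu> \<inter> elts \<beta>. \<alpha> \<in> elts \<gamma>)"
    then have ne: "elts \<beta> \<noteq> {}"
      and lim: "\<And>\<alpha>. \<alpha> \<in> elts \<beta> \<Longrightarrow> \<exists>\<xi>\<in>elts \<nu>. h \<xi> \<in> elts \<beta> \<and> \<alpha> \<in> elts (h \<xi>)" by blast+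
    have o\<beta>: "ordinal \<beta>" using ordinal_elt[OF ord \<beta>] .
    \<comment> \<open>A limit \<open>\<beta>\<close> of values of \<open>h\<close> is attained at the first argument where \<open>h\<close> reaches it.\<close>
    define \<Xi> where "\<Xi> = vset {\<xi> \<in> elts \<nu>. h \<xi> \<in> elts \<beta>}"
    have \<Xi>: "elts \<Xi> = {\<xi> \<in> elts \<nu>. h \<xi> \<in> elts \<beta>}"
      unfolding \<Xi>_def by (rule elts_vset, rule small_subset[OF small_elts[of \<nu>]]) blast
    have o\<Xi>: "ordinal \<Xi>"
    proof (rule ordinalI)
      fix \<xi> assume "\<xi> \<in> elts \<Xi>"
      then have \<xi>: "\<xi> \<in> elts \<nu>" "h \<xi> \<in> elts \<beta>" using \<Xi> by blast+
      have "elts \<xi> \<subseteq> elts \<Xi>"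
      proof
        fix \<eta> assume \<eta>: "\<eta> \<in> elts \<xi>"
        then have \<eta>\<nu>: "\<eta> \<in> elts \<nu>" using ordinal_trans[OF o\<nu> \<xi>(1)] by blast
        have "elts (h \<eta>) \<subseteq> elts (h \<xi>)"
          using h_mono[OF \<eta>\<nu> \<xi>(1) ordinal_mem_subset[OF ordinal_elt[OF o\<nu> \<xi>(1)] \<eta>]] .
        then have "h \<eta> \<in> elts \<beta>" using ordinal_subset_mem[OF oh[OF \<eta>\<nu>] o\<beta> _ \<xi>(2)] by blast
        then show "\<eta> \<in> elts \<Xi>" using \<Xi> \<eta>\<nu> by blast
      qed
      then show "ordinal \<xi> \<and> elts \<xi> \<subseteq> elts \<Xi>" using ordinal_elt[OF o\<nu> \<xi>(1)] by blast
    qed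
    have "\<Xi> \<noteq> \<nu>"
    proof
      assume eq: "\<Xi> = \<nu>"
      have "f \<eta> \<in> elts \<beta>" if \<eta>: "\<eta> \<in> elts \<nu>" for \<eta>
      proof -
        obtain \<xi> where \<xi>: "\<xi> \<in> elts \<nu>" "\<eta> \<in> elts \<xi>" using limit[OF \<eta>] by blast
        have "h \<xi> \<in> elts \<beta>" using \<Xi> eq \<xi>(1) by blast
        moreover have "f \<eta> \<in> elts (h \<xi>)" using h[OF \<xi>(1)] \<xi>(2) by blast
        ultimately show ?thesis using ordinal_trans[OF o\<beta>] by blast
      qed
      then show False using unb[OF \<beta>] by blast
    qed
    then have \<Xi>\<nu>: "\<Xi> \<in> elts \<nu>" using ordinal_subset_iff[OF o\<Xi> o\<nu>] \<Xi> by blast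
    have "elts (h \<Xi>) = elts \<beta>"
    proof (intro equalityI subsetI)
      fix x assume "x \<in> elts (h \<Xi>)"
      then consider "x \<in> elts \<nu>" | \<eta> where "\<eta> \<in> elts \<Xi>" "x = f \<eta> \<or> x \<in> elts (f \<eta>)"
        using h[OF \<Xi>\<nu>] by blast
      then show "x \<in> elts \<beta>"
      proof cases
        case 1
        obtain \<xi> where "\<xi> \<in> elts \<nu>" "h \<xi> \<in> elts \<beta>" using ne lim by blast
        then show ?thesis using 1 h ordinal_trans[OF o\<beta>] by blast
      next
        case 2
        then have \<eta>: "\<eta> \<in> elts \<nu>" "h \<eta> \<in> elts \<beta>" using \<Xi> by blast+
        obtain \<xi> where \<xi>: "\<xi> \<in> elts \<nu>" "h \<xi> \<in> elts \<beta>" "h \<eta> \<in> elts (h \<xi>)" using lim[OF \<eta>(2)] by blast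
        have "\<not> elts \<xi> \<subseteq> elts \<eta>" using h_mono[OF \<xi>(1) \<eta>(1)] \<xi>(3) mem_not_refl by blast
        then have "\<eta> \<in> elts \<xi>"
          using ordinal_subset_linear[OF ordinal_elt[OF o\<nu> \<xi>(1)] ordinal_elt[OF o\<nu> \<eta>(1)]] by blast
        then have "x \<in> elts (h \<xi>)" using h[OF \<xi>(1)] 2(2) by blast
        then show ?thesis using ordinal_trans[OF o\<beta> \<xi>(2)] by blast
      qed
    next
      fix \<alpha> assume "\<alpha> \<in> elts \<beta>"
      then obtain \<xi> where \<xi>: "\<xi> \<in> elts \<nu>" "h \<xi> \<in> elts \<beta>" "\<alpha> \<in> elts (h \<xi>)" using lim by blast
      then have "\<xi> \<in> elts \<Xi>" using \<Xi> by blast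
      then have "elts (h \<xi>) \<subseteq> elts (h \<Xi>)"
        using h_mono[OF \<xi>(1) \<Xi>\<nu>] ordinal_mem_subset[OF o\<Xi>] by blast
      then show "\<alpha> \<in> elts (h \<Xi>)" using \<xi>(3) by blast
    qed
    then show "\<beta> \<in> h ` elts \<nu>" using \<Xi>\<nu> extensionality by blast
  qed
  moreover have hinv: "inv_into (elts \<nu>) h \<alpha> \<in> elts \<nu>" "h (inv_into (elts \<nu>) h \<alpha>) = \<alpha>"
    if "\<alpha> \<in> elts C" for \<alpha>
    using that unfolding C by (auto intro: inv_into_into f_inv_into_f)
  moreover have "inj_on (inv_into (elts \<nu>) h) (elts C)"
    unfolding C by (rule inj_on_inv_into) simp
  moreover have "inv_into (elts \<nu>) h \<alpha> \<in> elts \<alpha>" if "\<alpha> \<in> elts C" for \<alpha>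
    using hinv[OF that] h[OF hinv(1)[OF that]] by auto
  ultimately show ?thesis by blast
qed

text \<open>
  The combinatorial clause of subtlety, stated apart from regularity and uncountability so that these can be
  derived from it.
\<close>

definition subtle_property :: "'v::zfc_universe \<Rightarrow> bool" where
  "subtle_property \<kappa> \<longleftrightarrow> (\<forall>d C. is_list \<kappa> d \<and> club C \<kappa> \<longrightarrow>
     (\<exists>\<alpha>\<in>elts C. \<exists>\<beta>\<in>elts C. \<alpha> \<in> elts \<beta> \<and> elts (d \<alpha>) = elts (d \<beta>) \<inter> elts \<alpha>))"

text \<open>
  For the list \<open>d \<alpha> = {g \<alpha>}\<close>, coherence \<open>d \<alpha> = d \<beta> \<inter> \<alpha>\<close> forces \<open>g \<alpha> = g \<beta>\<close>.
\<close>

lemma subtle_property_not_regressive_inj: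
  assumes sp: "subtle_property \<kappa>" and C: "club C \<kappa>"
    and g: "\<And>\<alpha>. \<alpha> \<in> elts C \<Longrightarrow> g \<alpha> \<in> elts \<alpha>" and inj: "inj_on g (elts C)"
  shows False
proof -
  define d where "d \<alpha> = (if \<alpha> \<in> elts C then vset {g \<alpha>} else vset {})" for \<alpha>
  have "is_list \<kappa> d" using g by (simp add: is_list_def d_def)
  then obtain \<alpha> \<beta> where *: "\<alpha> \<in> elts C" "\<beta> \<in> elts C" "\<alpha> \<in> elts \<beta>"
      "elts (d \<alpha>) = elts (d \<beta>) \<inter> elts \<alpha>"
    using sp C unfolding subtle_property_def by blast
  then have "{g \<alpha>} = {g \<beta>} \<inter> elts \<alpha>" by (simp add: d_def)
  then have "\<alpha> = \<beta>" using inj_onD[OF inj _ *(1,2)] by blast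
  then show False using * mem_not_refl by blast
qed

lemma subtleI:
  assumes \<kappa>: "cardinal \<kappa>" "infinite (elts \<kappa>)" and sp: "subtle_property \<kappa>"
  shows "subtle \<kappa>"
proof -
  have none: "\<not> (\<exists>C g. club C \<kappa> \<and> (\<forall>\<alpha>\<in>elts C. g \<alpha> \<in> elts \<alpha>) \<and> inj_on g (elts C))"
    using subtle_property_not_regressive_inj[OF sp] by blast
  then have "uncountable (elts \<kappa>)" "regular_cardinal \<kappa>"
    using countable_regressive_club[OF \<kappa>] singular_regressive_club[OF \<kappa>] by blast+
  then show ?thesis using sp unfolding subtle_def subtle_property_def by blast
qed

section \<open>Hulls under families of finitary functions\<close>

text \<open>
  The functions take lists, so that one family can contain functions of all finite arities.
\<close>

inductive_set hull :: "('i \<Rightarrow> 'a list \<Rightarrow> 'a) \<Rightarrow> 'a set \<Rightarrow> 'a set" for f A where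
  base: "a \<in> A \<Longrightarrow> a \<in> hull f A"
| step: "(\<And>x. x \<in> set l \<Longrightarrow> x \<in> hull f A) \<Longrightarrow> f i l \<in> hull f A"

lemma hull_mono:
  assumes "A \<subseteq> B" shows "hull f A \<subseteq> hull f B"
proof
  fix x assume "x \<in> hull f A"
  then show "x \<in> hull f B"
    by induction (use assms in \<open>auto intro: hull.intros\<close>)
qed

lemma hull_subset:
  assumes "A \<subseteq> B" "\<And>i l. set l \<subseteq> B \<Longrightarrow> f i l \<in> B" shows "hull f A \<subseteq> B"
proof
  fix x assume "x \<in> hull f A"
  then show "x \<in> B"
  proof induction
    case (step l i)
    then have "set l \<subseteq> B" by blast
    then show ?case by (rule assms(2))
  qed (use assms(1) in blast)
qed

text \<open>
  An element of the hull is generated from \<open>A\<close> in finitely many steps. This is what makes closure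
  points closed under limits.
\<close>

lemma hull_finitary:
  assumes "x \<in> hull f A" shows "\<exists>F. finite F \<and> F \<subseteq> A \<and> x \<in> hull f F"
  using assms
proof induction
  case (base a)
  then show ?case by (intro exI[of _ "{a}"]) (auto intro: hull.base)
next
  case (step l i)
  then obtain F where F: "\<And>x. x \<in> set l \<Longrightarrow> finite (F x) \<and> F x \<subseteq> A \<and> x \<in> hull f (F x)"
    by metis
  have "x \<in> hull f (\<Union>x\<in>set l. F x)" if "x \<in> set l" for x
    using F[OF that] hull_mono[of "F x" "\<Union>x\<in>set l. F x" f] that by blast
  then have "f i l \<in> hull f (\<Union>x\<in>set l. F x)" by (rule hull.step)
  then show ?case using F by (intro exI[of _ "\<Union>x\<in>set l. F x"]) auto
qed

text \<open>
  The hull is exhausted by countably many stages \<open>L n\<close>, each obtained from the preceding one by applying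
  countably many functions to finite lists, so that no stage exceeds the cardinality of \<open>K\<close>.
\<close>

lemma hull_lepoll:
  fixes f :: "'i::countable \<Rightarrow> 'a list \<Rightarrow> 'a"
  assumes K: "infinite K" and A: "A \<lesssim> K" shows "hull f A \<lesssim> K"
proof -
  define L where "L n = ((\<lambda>S. S \<union> (\<Union>i. f i ` lists S)) ^^ n) A" for n
  have nat: "(UNIV::nat set) \<lesssim> K" using K infinite_le_lepoll by blast
  have i: "(UNIV::'i set) \<lesssim> K"
    using nat by (meson inj_to_nat lepoll_def lepoll_trans subset_UNIV)
  have L0: "L 0 = A" and LS: "L (Suc n) = L n \<union> (\<Union>i. f i ` lists (L n))" for n
    by (simp_all add: L_def)
  have "L n \<lesssim> K" for n
  proof (induction n)
    case (Suc n)
    show ?case unfolding LS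
      by (intro infinite_Un_lepoll infinite_UN_lepoll K i Suc
          lepoll_trans[OF image_lepoll infinite_lists_lepoll])
  qed (simp add: L0 A)
  then have "(\<Union>n. L n) \<lesssim> K" by (intro infinite_UN_lepoll K nat)
  moreover have "hull f A \<subseteq> (\<Union>n. L n)"
  proof (rule hull_subset)
    show "A \<subseteq> (\<Union>n. L n)" using L0 by blast
  next
    fix i l assume l: "set l \<subseteq> (\<Union>n. L n)"
    have mono: "L m \<subseteq> L n" if "m \<le> n" for m n
      using lift_Suc_mono_le[of L, OF _ that] LS by blast
    have "\<exists>n. set l \<subseteq> L n"
      using l
    proof (induction l)
      case (Cons a l)
      then obtain n m where "set l \<subseteq> L n" "a \<in> L m" by auto
      then have "set (a # l) \<subseteq> L (max m n)" using mono[of m "max m n"] mono[of n "max m n"] by auto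
      then show ?case by blast
    qed simp
    then obtain n where "l \<in> lists (L n)" by auto
    then have "f i l \<in> L (Suc n)" unfolding LS by blast
    then show "f i l \<in> (\<Union>n. L n)" by blast
  qed
  ultimately show ?thesis using subset_imp_lepoll lepoll_trans by blast
qed

section \<open>Clubs of closure points\<close>

lemma finite_subset_cofinal_bound:
  assumes "finite F" "F \<subseteq> elts \<beta>" "ordinal \<beta>" "S \<subseteq> elts \<beta>" "S \<noteq> {}"
    and cof: "\<And>\<alpha>. \<alpha> \<in> elts \<beta> \<Longrightarrow> \<exists>\<gamma>\<in>S. \<alpha> \<in> elts \<gamma>"
  shows "\<exists>\<gamma>\<in>S. F \<subseteq> elts \<gamma>"
proof (cases "F = {}")
  case True
  then show ?thesis using assms(5) by blast
next
  case False
  have oF: "ordinal x" if "x \<in> F" for x using assms(2,3) ordinal_elt that by blast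
  obtain m where m: "m \<in> F" "\<And>x. x \<in> F \<Longrightarrow> elts x \<subseteq> elts m"
    using finite_subset_ordinal_bound[OF assms(1) False oF] by blast
  obtain \<gamma> where \<gamma>: "\<gamma> \<in> S" "m \<in> elts \<gamma>" using cof m(1) assms(2) by blast
  have "ordinal \<gamma>" using \<gamma>(1) assms(3,4) ordinal_elt by blast
  then have "x \<in> elts \<gamma>" if "x \<in> F" for x
    using ordinal_subset_mem[OF oF[OF that] _ m(2)[OF that] \<gamma>(2)] by blast
  then have "F \<subseteq> elts \<gamma>" by blast
  then show ?thesis using \<gamma>(1) by blast
qed

text \<open>
  Any element of the hull of \<open>\<beta> \<union> P\<close> is generated by finitely many elements, and those in \<open>\<beta>\<close>
  lie below a common \<open>\<gamma> \<in> S\<close>.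
\<close>

lemma hull_closure_points:
  fixes f :: "'i \<Rightarrow> 'v::zfc_universe list \<Rightarrow> 'v"
  assumes \<beta>: "ordinal \<beta>" and S: "S \<subseteq> elts \<beta>" "S \<noteq> {}"
    and cof: "\<And>\<alpha>. \<alpha> \<in> elts \<beta> \<Longrightarrow> \<exists>\<gamma>\<in>S. \<alpha> \<in> elts \<gamma>"
    and cl: "\<And>\<gamma>. \<gamma> \<in> S \<Longrightarrow> hull f (elts \<gamma> \<union> P) \<inter> K \<subseteq> elts \<beta>"
  shows "hull f (elts \<beta> \<union> P) \<inter> K \<subseteq> elts \<beta>"
proof
  fix x assume x: "x \<in> hull f (elts \<beta> \<union> P) \<inter> K"
  then obtain F where F: "finite F" "F \<subseteq> elts \<beta> \<union> P" "x \<in> hull f F" using hull_finitary[of x f] by blast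
  have "finite (F \<inter> elts \<beta>)" using F(1) by blast
  from finite_subset_cofinal_bound[OF this Int_lower2 \<beta> S cof]
  obtain \<gamma> where \<gamma>: "\<gamma> \<in> S" "F \<inter> elts \<beta> \<subseteq> elts \<gamma>" by blast
  then have "F \<subseteq> elts \<gamma> \<union> P" using F(2) by blast
  then have "x \<in> hull f (elts \<gamma> \<union> P)" using F(3) hull_mono by blast
  then show "x \<in> elts \<beta>" using x cl[OF \<gamma>(1)] by blast
qed

text \<open>
  For \<open>\<beta> < \<kappa>\<close> the hull has cardinality less than \<open>\<kappa>\<close>, so by regularity its trace on \<open>\<kappa>\<close> is bounded
  by some \<open>s \<beta> \<in> C\<close>. Iterating \<open>s\<close> countably often from \<open>\<alpha>\<close> leads to a closure point above
  \<open>\<alpha>\<close>, which is still below \<open>\<kappa>\<close> because \<open>\<kappa>\<close> is regular and uncountable.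
\<close>

lemma club_hull_closure_points:
  fixes f :: "'i::countable \<Rightarrow> 'v::zfc_universe list \<Rightarrow> 'v"
  assumes reg: "regular_cardinal \<kappa>" and unc: "uncountable (elts \<kappa>)"
    and C: "club C \<kappa>" and P: "finite P"
  defines "D \<equiv> vset {\<beta> \<in> elts C. hull f (elts \<beta> \<union> P) \<inter> elts \<kappa> \<subseteq> elts \<beta>}"
  shows "elts D = {\<beta> \<in> elts C. hull f (elts \<beta> \<union> P) \<inter> elts \<kappa> \<subseteq> elts \<beta>}" and "club D \<kappa>"
proof -
  show D: "elts D = {\<beta> \<in> elts C. hull f (elts \<beta> \<union> P) \<inter> elts \<kappa> \<subseteq> elts \<beta>}"
    unfolding D_def by (rule elts_vset, rule small_subset[OF small_elts[of C]]) blast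
  have \<kappa>: "cardinal \<kappa>" "infinite (elts \<kappa>)" using reg by (auto simp: regular_cardinal_def)
  then have ord: "ordinal \<kappa>" by (simp add: cardinal_def)
  have C\<kappa>: "elts C \<subseteq> elts \<kappa>" using C by (simp add: club_def)
  obtain \<omega> where \<omega>: "\<omega> \<in> elts \<kappa>" "infinite (elts \<omega>)" using uncountable_ordinal_infinite_elt[OF ord unc] .
  have step: "\<exists>\<gamma>\<in>elts C. \<beta> \<in> elts \<gamma> \<and> hull f (elts \<beta> \<union> P) \<inter> elts \<kappa> \<subseteq> elts \<gamma>"
    if \<beta>: "\<beta> \<in> elts \<kappa>" for \<beta>
  proof -
    \<comment> \<open>Passing above \<open>\<omega>\<close> makes the bound \<open>\<nu>\<close> infinite, as the cardinality estimate for hulls requires.\<close>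
    obtain \<nu> where \<nu>: "\<nu> \<in> elts \<kappa>" "\<beta> \<in> elts \<nu>" "\<omega> \<in> elts \<nu>"
      using infinite_cardinal_join[OF \<kappa> \<beta> \<omega>(1)] .
    have sub: "elts \<beta> \<subseteq> elts \<nu>" "elts \<omega> \<subseteq> elts \<nu>"
      using ordinal_mem_subset[OF ordinal_elt[OF ord \<nu>(1)]] \<nu> by blast+
    then have inf: "infinite (elts \<nu>)" using \<omega>(2) finite_subset by blast
    have "elts \<beta> \<union> P \<lesssim> elts \<nu>"
      by (intro infinite_Un_lepoll inf subset_imp_lepoll[OF sub(1)] finite_lepoll_infinite P)
    then have "hull f (elts \<beta> \<union> P) \<lesssim> elts \<nu>" by (rule hull_lepoll[OF inf])
    then have "hull f (elts \<beta> \<union> P) \<inter> elts \<kappa> \<lesssim> elts \<nu>"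
      by (rule lepoll_trans[OF subset_imp_lepoll[OF Int_lower1]])
    then obtain \<delta> where \<delta>: "\<delta> \<in> elts \<kappa>" "hull f (elts \<beta> \<union> P) \<inter> elts \<kappa> \<subseteq> elts \<delta>"
      using regular_cardinal_bound[OF reg \<nu>(1) Int_lower2] by blast
    obtain \<xi> where \<xi>: "\<xi> \<in> elts \<kappa>" "\<beta> \<in> elts \<xi>" "\<delta> \<in> elts \<xi>"
      using infinite_cardinal_join[OF \<kappa> \<beta> \<delta>(1)] .
    obtain \<gamma> where \<gamma>: "\<gamma> \<in> elts C" "elts \<xi> \<subseteq> elts \<gamma>" using C \<xi>(1) unfolding club_def by blast
    have "elts \<delta> \<subseteq> elts \<gamma>" using ordinal_mem_subset[OF ordinal_elt[OF ord \<xi>(1)] \<xi>(3)] \<gamma>(2) by blast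
    then show ?thesis using \<gamma> \<xi>(2) \<delta>(2) by blast
  qed
  then obtain s where s: "\<And>\<beta>. \<beta> \<in> elts \<kappa> \<Longrightarrow>
      s \<beta> \<in> elts C \<and> \<beta> \<in> elts (s \<beta>) \<and> hull f (elts \<beta> \<union> P) \<inter> elts \<kappa> \<subseteq> elts (s \<beta>)"
    by metis
  show "club D \<kappa>"
    unfolding club_def
  proof (intro conjI ballI impI)
    show "elts D \<subseteq> elts \<kappa>" using D C\<kappa> by blast
  next
    fix \<alpha> assume \<alpha>: "\<alpha> \<in> elts \<kappa>"
    \<comment> \<open>The iteration starts at \<open>s \<alpha>\<close> and not at \<open>\<alpha>\<close>, which need not be in \<open>C\<close>.\<close>
    define a where "a n = (s ^^ Suc n) \<alpha>" for n
    have aS: "a (Suc n) = s (a n)" for n by (simp add: a_def)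
    have aC: "a n \<in> elts C" for n
      by (induction n) (use s \<alpha> C\<kappa> in \<open>auto simp: a_def\<close>)
    then have a\<kappa>: "a n \<in> elts \<kappa>" for n using C\<kappa> by blast
    have oa: "ordinal (a n)" for n using ordinal_elt[OF ord a\<kappa>] .
    have a_mem: "a n \<in> elts (a (Suc n))" for n unfolding aS using s[OF a\<kappa>] by blast
    have "range a \<lesssim> elts \<omega>"
      using \<omega>(2) lepoll_trans[OF image_lepoll] unfolding infinite_le_lepoll by blast
    then obtain \<delta> where \<delta>: "\<delta> \<in> elts \<kappa>" "range a \<subseteq> elts \<delta>"
      using regular_cardinal_bound[OF reg \<omega>(1), of "range a"] a\<kappa> by blast
    have o\<delta>: "ordinal \<delta>" using ordinal_elt[OF ord \<delta>(1)] .
    define \<beta> where "\<beta> = vset (\<Union>n. elts (a n))"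
    have \<beta>: "elts \<beta> = (\<Union>n. elts (a n))" unfolding \<beta>_def by (intro elts_vset small_UN_nat small_elts)
    have o\<beta>: "ordinal \<beta>"
    proof (rule ordinalI)
      fix \<xi> assume "\<xi> \<in> elts \<beta>"
      then obtain n where "\<xi> \<in> elts (a n)" using \<beta> by blast
      then show "ordinal \<xi> \<and> elts \<xi> \<subseteq> elts \<beta>"
        using ordinal_elt[OF oa] ordinal_mem_subset[OF oa] \<beta> by blast
    qed
    have "elts \<beta> \<subseteq> elts \<delta>" using \<beta> \<delta>(2) ordinal_mem_subset[OF o\<delta>] by blast
    then have \<beta>\<kappa>: "\<beta> \<in> elts \<kappa>" using ordinal_subset_mem[OF o\<beta> ord _ \<delta>(1)] by blast
    have a\<beta>: "a n \<in> elts \<beta>" for n using a_mem \<beta> by blast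
    have cof: "\<exists>\<gamma>\<in>range a. \<xi> \<in> elts \<gamma>" if "\<xi> \<in> elts \<beta>" for \<xi> using that \<beta> by blast
    then have "\<exists>\<gamma>\<in>elts C \<inter> elts \<beta>. \<xi> \<in> elts \<gamma>" if "\<xi> \<in> elts \<beta>" for \<xi>
      using that aC a\<beta> by blast
    then have "\<beta> \<in> elts C" using C \<beta>\<kappa> a\<beta> unfolding club_def by blast
    moreover have "hull f (elts \<beta> \<union> P) \<inter> elts \<kappa> \<subseteq> elts \<beta>"
    proof (rule hull_closure_points[OF o\<beta> _ _ cof])
      fix \<gamma> assume "\<gamma> \<in> range a"
      then obtain n where "\<gamma> = a n" by blast
      then have "hull f (elts \<gamma> \<union> P) \<inter> elts \<kappa> \<subseteq> elts (a (Suc n))" using s[OF a\<kappa>] aS by metis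
      then show "hull f (elts \<gamma> \<union> P) \<inter> elts \<kappa> \<subseteq> elts \<beta>" using \<beta> by blast
    qed (use a\<beta> in auto)
    ultimately have "\<beta> \<in> elts D" using D by blast
    moreover have "elts \<alpha> \<subseteq> elts \<beta>"
    proof -
      have "\<alpha> \<in> elts (a 0)" using s[OF \<alpha>] by (simp add: a_def)
      then show ?thesis using \<beta> ordinal_mem_subset[OF oa] by blast
    qed
    ultimately show "\<exists>\<gamma>\<in>elts D. elts \<alpha> \<subseteq> elts \<gamma>" by blast
  next
    fix \<beta> assume \<beta>: "\<beta> \<in> elts \<kappa>"
      and "elts \<beta> \<noteq> {} \<and> (\<forall>\<alpha>\<in>elts \<beta>. \<exists>\<gamma>\<in>elts D \<inter> elts \<beta>. \<alpha> \<in> elts \<gamma>)"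
    then have ne: "elts \<beta> \<noteq> {}"
      and lim: "\<And>\<alpha>. \<alpha> \<in> elts \<beta> \<Longrightarrow> \<exists>\<gamma>\<in>elts D \<inter> elts \<beta>. \<alpha> \<in> elts \<gamma>" by blast+
    have "\<exists>\<gamma>\<in>elts C \<inter> elts \<beta>. \<alpha> \<in> elts \<gamma>" if "\<alpha> \<in> elts \<beta>" for \<alpha>
      using lim[OF that] D by blast
    then have "\<beta> \<in> elts C" using C \<beta> ne unfolding club_def by blast
    moreover have "hull f (elts \<beta> \<union> P) \<inter> elts \<kappa> \<subseteq> elts \<beta>"
    proof (rule hull_closure_points[OF ordinal_elt[OF ord \<beta>] _ _ lim])
      fix \<gamma> assume \<gamma>: "\<gamma> \<in> elts D \<inter> elts \<beta>"
      then have "elts \<gamma> \<subseteq> elts \<beta>" using ordinal_mem_subset[OF ordinal_elt[OF ord \<beta>]] by blast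
      then show "hull f (elts \<gamma> \<union> P) \<inter> elts \<kappa> \<subseteq> elts \<beta>" using \<gamma> D by blast
    qed (use ne lim in blast)+
    ultimately show "\<beta> \<in> elts D" using D by blast
  qed
qed

section \<open>Elementary substructures\<close>

instance fm :: countable by countable_datatype

primrec var_bound :: "fm \<Rightarrow> nat" where
  "var_bound (Mem m n) = Suc (max m n)"
| "var_bound (Eq m n) = Suc (max m n)"
| "var_bound (Neg \<phi>) = var_bound \<phi>"
| "var_bound (Conj \<phi> \<psi>) = max (var_bound \<phi>) (var_bound \<psi>)"
| "var_bound (Exists n \<phi>) = var_bound \<phi>"

text \<open>
  Parameters of a Skolem function form a list \<open>l\<close>, used as the assignment \<open>(!) l\<close>. Beyond its length
  this assignment takes arbitrary values, possibly outside the structure, which is harmless once \<open>l\<close> covers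
  all variables of the formula.
\<close>

lemma sat_cong:
  "(\<And>i. i < var_bound \<phi> \<Longrightarrow> s i = t i) \<Longrightarrow> sat M \<phi> s \<longleftrightarrow> sat M \<phi> t"
proof (induction \<phi> arbitrary: s t)
  case (Exists n \<phi>)
  have "sat M \<phi> (s(n := x)) \<longleftrightarrow> sat M \<phi> (t(n := x))" for x
    using Exists.prems by (intro Exists.IH) auto
  then show ?case by simp
next
  case (Conj \<phi> \<psi>)
  have "sat M \<phi> s \<longleftrightarrow> sat M \<phi> t" "sat M \<psi> s \<longleftrightarrow> sat M \<psi> t"
    using Conj.prems by (auto intro!: Conj.IH)
  then show ?case by simp
next
  case (Neg \<phi>)
  have "sat M \<phi> s \<longleftrightarrow> sat M \<phi> t" using Neg.prems by (auto intro!: Neg.IH)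
  then show ?case by simp
qed auto

text \<open>
  Without a witness the value is an arbitrary element of \<open>H\<close>, so that hulls of subsets of \<open>H\<close> stay
  inside \<open>H\<close>.
\<close>

definition skolem :: "'v::zfc_universe set \<Rightarrow> fm \<times> nat \<Rightarrow> 'v list \<Rightarrow> 'v" where
  "skolem H = (\<lambda>(\<phi>, n) l. SOME x. x \<in> H \<and>
     ((\<exists>y\<in>H. sat H \<phi> (((!) l)(n := y))) \<longrightarrow> sat H \<phi> (((!) l)(n := x))))"

lemma skolem:
  assumes "H \<noteq> {}"
  shows "skolem H (\<phi>, n) l \<in> H"
    and "y \<in> H \<Longrightarrow> sat H \<phi> (((!) l)(n := y)) \<Longrightarrow> sat H \<phi> (((!) l)(n := skolem H (\<phi>, n) l))"
proof -
  have "\<exists>x. x \<in> H \<and> ((\<exists>y\<in>H. sat H \<phi> (((!) l)(n := y))) \<longrightarrow> sat H \<phi> (((!) l)(n := x)))"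
    using assms by blast
  then have "skolem H (\<phi>, n) l \<in> H \<and> ((\<exists>y\<in>H. sat H \<phi> (((!) l)(n := y))) \<longrightarrow>
      sat H \<phi> (((!) l)(n := skolem H (\<phi>, n) l)))"
    unfolding skolem_def prod.case by (rule someI_ex)
  then show "skolem H (\<phi>, n) l \<in> H"
    and "y \<in> H \<Longrightarrow> sat H \<phi> (((!) l)(n := y)) \<Longrightarrow> sat H \<phi> (((!) l)(n := skolem H (\<phi>, n) l))"
    by blast+
qed

text \<open>
  The Tarski--Vaught argument: an existential formula true in \<open>H\<close> of parameters from the hull has a
  witness in the hull, namely the value of its Skolem function.
\<close>

lemma sat_skolem_hull:
  assumes H: "H \<noteq> {}" "A \<subseteq> H"
  shows "range s \<subseteq> hull (skolem H) A \<Longrightarrow> sat (hull (skolem H) A) \<phi> s \<longleftrightarrow> sat H \<phi> s"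
proof (induction \<phi> arbitrary: s)
  case (Exists n \<phi>)
  let ?X = "hull (skolem H) A"
  have XH: "?X \<subseteq> H" using H skolem(1)[OF H(1)] by (intro hull_subset) auto
  have IH: "sat ?X \<phi> (s(n := x)) \<longleftrightarrow> sat H \<phi> (s(n := x))" if "x \<in> ?X" for x
    using Exists that by (intro Exists.IH) auto
  have "\<exists>x\<in>?X. sat H \<phi> (s(n := x))" if y: "y \<in> H" "sat H \<phi> (s(n := y))" for y
  proof
    define l where "l = map s [0..<var_bound \<phi>]"
    define x where "x = skolem H (\<phi>, n) l"
    have "x \<in> ?X" unfolding x_def
      by (rule hull.step) (use Exists.prems in \<open>auto simp: l_def\<close>)
    then show "x \<in> ?X" .
    have eq: "sat H \<phi> (s(n := z)) \<longleftrightarrow> sat H \<phi> (((!) l)(n := z))" for z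
      by (rule sat_cong) (auto simp: l_def)
    show "sat H \<phi> (s(n := x))"
      using skolem(2)[OF H(1) y(1), of \<phi> l n] y(2) unfolding eq x_def by blast
  qed
  then show ?case using IH XH by auto
qed auto

section \<open>Critical points\<close>

lemma crit_eqI:
  assumes "\<mu> \<in> M" "ordinal \<mu>" "\<mu> \<in> elts (j \<mu>)"
    and below: "\<And>\<gamma>. \<gamma> \<in> M \<Longrightarrow> \<gamma> \<in> elts \<mu> \<Longrightarrow> \<gamma> \<notin> elts (j \<gamma>)"
  shows "crit M j = \<mu>"
  unfolding crit_def
proof (rule the_equality)
  have "elts \<mu> \<subseteq> elts \<beta>" if "\<beta> \<in> M" "ordinal \<beta>" "\<beta> \<in> elts (j \<beta>)" for \<beta>
    using ordinal_subset_linear[OF assms(2) that(2)] below[OF that(1)] that(3) by blast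
  then show *: "\<mu> \<in> M \<and> ordinal \<mu> \<and> \<mu> \<in> elts (j \<mu>) \<and>
      (\<forall>\<beta>\<in>M. ordinal \<beta> \<and> \<beta> \<in> elts (j \<beta>) \<longrightarrow> elts \<mu> \<subseteq> elts \<beta>)"
    using assms by blast
  fix \<alpha>
  assume "\<alpha> \<in> M \<and> ordinal \<alpha> \<and> \<alpha> \<in> elts (j \<alpha>) \<and>
      (\<forall>\<beta>\<in>M. ordinal \<beta> \<and> \<beta> \<in> elts (j \<beta>) \<longrightarrow> elts \<alpha> \<subseteq> elts \<beta>)"
  then have "elts \<alpha> = elts \<mu>" using * by blast
  then show "\<alpha> = \<mu>" by (rule extensionality)
qed

text \<open>
  Ordinals moved upwards exist by nontriviality, hence so does a least one. By transitivity of \<open>M\<close>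
  all smaller ordinals are in \<open>M\<close>, and they are not moved upwards.
\<close>

lemma crit_properties:
  assumes tr: "transitive_set M" and nt: "nontrivial_embedding (elts M) j"
  shows "crit (elts M) j \<in> elts M" "ordinal (crit (elts M) j)"
    "crit (elts M) j \<in> elts (j (crit (elts M) j))"
    "\<gamma> \<in> elts (crit (elts M) j) \<Longrightarrow> \<gamma> \<notin> elts (j \<gamma>)"
proof -
  let ?Q = "\<lambda>\<alpha>. \<alpha> \<in> elts M \<and> ordinal \<alpha> \<and> \<alpha> \<in> elts (j \<alpha>)"
  obtain \<alpha> where "?Q \<alpha>" using nt unfolding nontrivial_embedding_def by blast
  then obtain \<mu> where \<mu>: "?Q \<mu>" and least: "\<And>\<gamma>. \<gamma> \<in> elts \<mu> \<Longrightarrow> \<not> ?Q \<gamma>"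
    using ex_mem_minimal[of ?Q \<alpha>] by blast
  have least': "\<gamma> \<notin> elts (j \<gamma>)" if "\<gamma> \<in> elts \<mu>" for \<gamma>
    using least[OF that] \<mu> that ordinal_elt tr unfolding transitive_set_def by blast
  then have "crit (elts M) j = \<mu>" using crit_eqI[of \<mu> "elts M" j] \<mu> by blast
  then show "crit (elts M) j \<in> elts M" "ordinal (crit (elts M) j)"
    "crit (elts M) j \<in> elts (j (crit (elts M) j))"
    "\<gamma> \<in> elts (crit (elts M) j) \<Longrightarrow> \<gamma> \<notin> elts (j \<gamma>)"
    using \<mu> least' by blast+
qed

lemma Hset_transitive:
  assumes "x \<in> Hset \<theta>" "y \<in> elts x" shows "y \<in> Hset \<theta>"
  using assms lesspoll_trans1[OF subset_imp_lepoll[OF transitive_closure_mono[OF assms(2)]]]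
  unfolding Hset_def by blast

lemma elementary_embedding_mem_iff:
  assumes "elementary_embedding M N j" "a \<in> M" "b \<in> M"
  shows "a \<in> elts b \<longleftrightarrow> j a \<in> elts (j b)"
proof -
  define s where "s i = (if i = 0 then a else b)" for i :: nat
  have "range s \<subseteq> M" using assms(2,3) by (auto simp: s_def)
  then have "sat M (Mem 0 1) s \<longleftrightarrow> sat N (Mem 0 1) (j \<circ> s)"
    using assms(1) unfolding elementary_embedding_def by blast
  then show ?thesis by (simp add: s_def)
qed

text \<open>Unboundedness of \<open>j y\<close> in \<open>j x\<close> is reflected by the formula \<open>\<forall>a \<in> x. \<exists>c \<in> y. a \<in> c\<close>.\<close>

lemma elementary_embedding_cofinal:
  assumes j: "elementary_embedding M N j" and x: "x \<in> M" "y \<in> M"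
    and N: "\<And>a. a \<in> elts (j x) \<Longrightarrow> \<exists>c\<in>N. c \<in> elts (j y) \<and> a \<in> elts c"
    and a: "a \<in> M" "a \<in> elts x"
  shows "\<exists>c\<in>M. c \<in> elts y \<and> a \<in> elts c"
proof -
  define \<phi> where "\<phi> = Neg (Exists 2 (Conj (Mem 2 0) (Neg (Exists 3 (Conj (Mem 3 1) (Mem 2 3))))))"
  define s where "s i = (if i = 0 then x else y)" for i :: nat
  have "sat N \<phi> (j \<circ> s)" using N by (auto simp: \<phi>_def s_def)
  moreover have "range s \<subseteq> M" using x by (auto simp: s_def)
  ultimately have "sat M \<phi> s" using j unfolding elementary_embedding_def by blast
  then show ?thesis using a by (auto simp: \<phi>_def s_def)
qed

text \<open>
  By induction along membership \<open>\<gamma> \<subseteq> j \<gamma>\<close>. As an element of the ordinal \<open>j (crit j)\<close>, the set \<open>j \<gamma>\<close> is itself an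
  ordinal; and \<open>j\<close> does not move \<open>\<gamma>\<close> upwards.
\<close>

lemma crit_fixes_below:
  assumes tr: "transitive_set M" and j: "elementary_embedding (elts M) N j"
    and nt: "nontrivial_embedding (elts M) j" and ord: "ordinal (j (crit (elts M) j))"
  shows "\<gamma> \<in> elts (crit (elts M) j) \<Longrightarrow> j \<gamma> = \<gamma>"
proof (induction \<gamma> rule: mem_induct)
  case (mem \<gamma>)
  let ?\<mu> = "crit (elts M) j"
  note \<mu> = crit_properties[OF tr nt]
  have \<gamma>M: "\<gamma> \<in> elts M" using \<mu>(1) tr mem.prems unfolding transitive_set_def by blast
  have o\<gamma>: "ordinal \<gamma>" using ordinal_elt[OF \<mu>(2) mem.prems] .
  have "j \<gamma> \<in> elts (j ?\<mu>)" using elementary_embedding_mem_iff[OF j \<gamma>M \<mu>(1)] mem.prems by blast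
  then have oj: "ordinal (j \<gamma>)" using ordinal_elt[OF ord] by blast
  have "elts \<gamma> \<subseteq> elts (j \<gamma>)"
  proof
    fix \<delta> assume \<delta>: "\<delta> \<in> elts \<gamma>"
    have "\<delta> \<in> elts M" using \<delta> \<gamma>M tr unfolding transitive_set_def by blast
    then have "j \<delta> \<in> elts (j \<gamma>)" using elementary_embedding_mem_iff[OF j _ \<gamma>M] \<delta> by blast
    moreover have "j \<delta> = \<delta>" using mem.IH[OF \<delta>] ordinal_trans[OF \<mu>(2) mem.prems \<delta>] by blast
    ultimately show "\<delta> \<in> elts (j \<gamma>)" by simp
  qed
  then show ?case using ordinal_subset_iff[OF o\<gamma> oj] \<mu>(4)[OF mem.prems] by auto
qed

text \<open>
  Write \<open>\<mu>\<close> for the critical point and \<open>C = j c\<close>. Since \<open>\<kappa>\<close> is a limit, every ordinal below \<open>\<kappa>\<close> is an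
  element of some element of \<open>C\<close>. By elementarity every ordinal below \<open>\<mu>\<close> is an element of some
  \<open>\<gamma> \<in> c\<close>. Such a \<open>\<gamma>\<close> is below \<open>\<mu>\<close>, hence fixed by \<open>j\<close> and in \<open>C\<close>. So \<open>\<mu>\<close> is a limit of
  \<open>C\<close>.
\<close>

lemma crit_mem_club:
  assumes \<kappa>: "cardinal \<kappa>" "infinite (elts \<kappa>)" and C: "club C \<kappa>"
    and se: "small_embedding \<kappa> \<theta> M j" and ran: "C \<in> j ` elts M"
    and ne: "elts (crit (elts M) j) \<noteq> {}"
  shows "crit (elts M) j \<in> elts C"
proof -
  let ?\<mu> = "crit (elts M) j"
  have tr: "transitive_set M" and j: "elementary_embedding (elts M) (Hset \<theta>) j"
    and nt: "nontrivial_embedding (elts M) j" and j\<mu>: "j ?\<mu> = \<kappa>"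
    using se unfolding small_embedding_def by blast+
  have ord: "ordinal \<kappa>" using \<kappa>(1) by (simp add: cardinal_def)
  note \<mu> = crit_properties[OF tr nt]
  note fixed = crit_fixes_below[OF tr j nt, unfolded j\<mu>, OF ord]
  obtain c where c: "c \<in> elts M" "j c = C" using ran by blast
  have CH: "C \<in> Hset \<theta>" using c j unfolding elementary_embedding_def by blast
  have C\<kappa>: "elts C \<subseteq> elts \<kappa>" using C unfolding club_def by blast
  have cof: "\<exists>\<gamma>\<in>Hset \<theta>. \<gamma> \<in> elts C \<and> \<alpha> \<in> elts \<gamma>" if "\<alpha> \<in> elts \<kappa>" for \<alpha>
  proof -
    obtain \<beta> where \<beta>: "\<beta> \<in> elts \<kappa>" "\<alpha> \<in> elts \<beta>" using infinite_cardinal_limit[OF \<kappa> \<open>\<alpha> \<in> elts \<kappa>\<close>] .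
    then obtain \<gamma> where "\<gamma> \<in> elts C" "elts \<beta> \<subseteq> elts \<gamma>" using C unfolding club_def by blast
    then show ?thesis using Hset_transitive[OF CH] \<beta> by blast
  qed
  have "\<exists>\<gamma>\<in>elts C \<inter> elts ?\<mu>. \<alpha> \<in> elts \<gamma>" if \<alpha>: "\<alpha> \<in> elts ?\<mu>" for \<alpha>
  proof -
    have "\<alpha> \<in> elts M" using \<alpha> \<mu>(1) tr unfolding transitive_set_def by blast
    then obtain \<gamma> where \<gamma>: "\<gamma> \<in> elts M" "\<gamma> \<in> elts c" "\<alpha> \<in> elts \<gamma>"
      using elementary_embedding_cofinal[OF j \<mu>(1) c(1), unfolded j\<mu> c(2), OF cof _ \<alpha>] by blast
    have j\<gamma>: "j \<gamma> \<in> elts C" using elementary_embedding_mem_iff[OF j \<gamma>(1) c(1)] \<gamma>(2) c(2) by blast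
    then have "\<gamma> \<in> elts ?\<mu>"
      using elementary_embedding_mem_iff[OF j \<gamma>(1) \<mu>(1)] C\<kappa> j\<mu> by auto
    then show ?thesis using fixed j\<gamma> \<gamma>(3) by auto
  qed
  moreover have "?\<mu> \<in> elts \<kappa>" using \<mu>(3) j\<mu> by simp
  ultimately show ?thesis using C ne unfolding club_def by blast
qed

section \<open>Small embeddings from elementary substructures\<close>

lemma HsetI:
  assumes \<theta>: "cardinal \<theta>" "\<kappa> \<in> elts \<theta>" and T: "transitive_closure x \<subseteq> T" "T \<lesssim> elts \<kappa>"
  shows "x \<in> Hset \<theta>"
  unfolding Hset_def mem_Collect_eq
  using lesspoll_trans1[OF lepoll_trans[OF subset_imp_lepoll[OF T(1)] T(2)] cardinal_lesspoll[OF \<theta>]] .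

lemma sat_iso:
  assumes M: "j ` M = X" and mem: "\<And>a b. a \<in> M \<Longrightarrow> b \<in> M \<Longrightarrow> a \<in> elts b \<longleftrightarrow> j a \<in> elts (j b)"
    and inj: "inj_on j M"
  shows "range s \<subseteq> M \<Longrightarrow> sat M \<phi> s \<longleftrightarrow> sat X \<phi> (j \<circ> s)"
proof (induction \<phi> arbitrary: s)
  case (Mem m n)
  then show ?case using mem[of "s m" "s n"] by auto
next
  case (Eq m n)
  then have "s m \<in> M" "s n \<in> M" by auto
  then show ?case using inj_on_eq_iff[OF inj] by simp
next
  case (Exists n \<phi>)
  have "sat M \<phi> (s(n := x)) \<longleftrightarrow> sat X \<phi> ((j \<circ> s)(n := j x))" if "x \<in> M" for x
  proof -
    have "j \<circ> s(n := x) = (j \<circ> s)(n := j x)" by auto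
    moreover have "range (s(n := x)) \<subseteq> M" using Exists.prems that by auto
    ultimately show ?thesis using Exists.IH by metis
  qed
  then show ?case unfolding sat.simps M[symmetric] by blast
qed auto

text \<open>
  If \<open>a \<subseteq> b\<close> fails, then by transitivity of \<open>H(\<theta>)\<close> it has a counterexample there, and by
  elementarity also in \<open>X\<close>.
\<close>

lemma elementary_extensional:
  assumes XH: "X \<subseteq> Hset \<theta>"
    and el: "\<And>\<phi> s. range s \<subseteq> X \<Longrightarrow> sat X \<phi> s \<longleftrightarrow> sat (Hset \<theta>) \<phi> s"
    and ab: "a \<in> X" "b \<in> X" "elts a \<inter> X \<subseteq> elts b"
  shows "elts a \<subseteq> elts b"
proof
  fix c assume c: "c \<in> elts a"
  define \<phi> where "\<phi> = Exists 2 (Conj (Mem 2 0) (Neg (Mem 2 1)))"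
  define s where "s i = (if i = 0 then a else b)" for i :: nat
  have "\<not> sat X \<phi> s" using ab(3) by (auto simp: \<phi>_def s_def)
  moreover have "range s \<subseteq> X" using ab by (auto simp: s_def)
  ultimately have "\<not> sat (Hset \<theta>) \<phi> s" using el by blast
  moreover have "c \<in> Hset \<theta>" using Hset_transitive c ab(1) XH by blast
  ultimately show "c \<in> elts b" using c by (auto simp: \<phi>_def s_def)
qed

text \<open>
  The embedding is the inverse of the Mostowski collapse of \<open>X\<close>. The collapse is the identity on
  \<open>\<beta> \<subseteq> X\<close>, and it sends \<open>\<kappa>\<close> to \<open>\<beta>\<close> since the elements of \<open>\<kappa>\<close> in \<open>X\<close> are exactly those of
  \<open>\<beta>\<close>.
\<close>

lemma small_embedding_of_elementary_substructure:
  assumes \<theta>: "cardinal \<theta>" "\<kappa> \<in> elts \<theta>" and \<kappa>: "ordinal \<kappa>"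
    and XH: "X \<subseteq> Hset \<theta>" and card: "X \<lesssim> elts \<kappa>"
    and el: "\<And>\<phi> s. range s \<subseteq> X \<Longrightarrow> sat X \<phi> s \<longleftrightarrow> sat (Hset \<theta>) \<phi> s"
    and \<beta>: "\<beta> \<in> elts \<kappa>" "\<kappa> \<in> X" "X \<inter> elts \<kappa> = elts \<beta>"
  obtains M j where "small_embedding \<kappa> \<theta> M j" "j ` elts M = X" "crit (elts M) j = \<beta>"
proof -
  define R where "R = {(u, v). u \<in> X \<and> v \<in> X \<and> u \<in> elts v}"
  interpret small_wf_extensional X R
  proof
    show "small X" using card by (rule small_lepoll)
    show "wf R" by (rule wf_subset[OF wf_mem]) (auto simp: R_def)
    show "R \<subseteq> X \<times> X" by (auto simp: R_def)
    fix a b assume ab: "a \<in> X" "b \<in> X" "{c. (c, a) \<in> R} = {c. (c, b) \<in> R}"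
    then have "elts a \<inter> X = elts b \<inter> X" by (auto simp: R_def)
    then have "elts a = elts b"
      using elementary_extensional[OF XH el ab(1,2)] elementary_extensional[OF XH el ab(2,1)] by blast
    then show "a = b" by (rule extensionality)
  qed
  define M where "M = vset (collapse R ` X)"
  have M: "elts M = collapse R ` X" unfolding M_def by (rule elts_vset_collapse)
  define j where "j = inv_into X (collapse R)"
  have jc: "j (collapse R a) = a" if "a \<in> X" for a
    unfolding j_def using inv_into_f_f[OF inj_on_collapse that] .
  have jM: "j ` elts M = X" unfolding M image_image using jc by simp
  have inj: "inj_on j (elts M)" unfolding M using jc by (auto simp: inj_on_def)
  have mem: "a \<in> elts b \<longleftrightarrow> j a \<in> elts (j b)" if "a \<in> elts M" "b \<in> elts M" for a b
  proof -
    obtain a' b' where "a' \<in> X" "b' \<in> X" "a = collapse R a'" "b = collapse R b'"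
      using \<open>a \<in> elts M\<close> \<open>b \<in> elts M\<close> unfolding M by blast
    then show ?thesis using collapse_mem_iff jc by (simp add: R_def)
  qed
  have ee: "elementary_embedding (elts M) (Hset \<theta>) j"
    unfolding elementary_embedding_def
  proof (intro conjI allI impI)
    show "j \<in> elts M \<rightarrow> Hset \<theta>" using jM XH by blast
    fix \<phi> and s :: "nat \<Rightarrow> 'a" assume s: "range s \<subseteq> elts M"
    then have "range (j \<circ> s) \<subseteq> X" using jM by auto
    then show "sat (elts M) \<phi> s \<longleftrightarrow> sat (Hset \<theta>) \<phi> (j \<circ> s)"
      using sat_iso[OF jM mem inj s] el by blast
  qed
  have o\<beta>: "ordinal \<beta>" using ordinal_elt[OF \<kappa> \<beta>(1)] .
  have fixed: "\<gamma> \<in> elts \<beta> \<Longrightarrow> collapse R \<gamma> = \<gamma>" for \<gamma>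
  proof (induction \<gamma> rule: mem_induct)
    case (mem \<gamma>)
    have "\<delta> \<in> X \<and> \<delta> \<in> elts \<beta>" if "\<delta> \<in> elts \<gamma>" for \<delta>
      using ordinal_trans[OF o\<beta> mem.prems that] \<beta>(3) by blast
    moreover have "\<gamma> \<in> X" using mem.prems \<beta>(3) by blast
    ultimately have "elts (collapse R \<gamma>) = elts \<gamma>"
      unfolding elts_collapse using mem.IH by (force simp: R_def)
    then show ?case by (rule extensionality)
  qed
  have "elts (collapse R \<kappa>) = collapse R ` elts \<beta>"
    unfolding elts_collapse using \<beta>(2,3) by (intro image_cong) (auto simp: R_def)
  also have "\<dots> = elts \<beta>" using fixed by simp
  finally have c\<kappa>: "collapse R \<kappa> = \<beta>" by (rule extensionality)
  then have j\<beta>: "j \<beta> = \<kappa>" using jc[OF \<beta>(2)] by simp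
  have \<beta>M: "\<beta> \<in> elts M" unfolding M using c\<kappa> \<beta>(2) by blast
  have crit: "crit (elts M) j = \<beta>"
  proof (rule crit_eqI[OF \<beta>M o\<beta>])
    show "\<beta> \<in> elts (j \<beta>)" using j\<beta> \<beta>(1) by simp
    fix \<gamma> assume "\<gamma> \<in> elts \<beta>"
    then have "j \<gamma> = \<gamma>" using jc[of \<gamma>] fixed[of \<gamma>] \<beta>(3) by auto
    then show "\<gamma> \<notin> elts (j \<gamma>)" using mem_not_refl by simp
  qed
  have tr: "transitive_set M" unfolding M_def by (rule transitive_collapse)
  have "M \<in> Hset \<theta>"
  proof (rule HsetI[OF \<theta>])
    show "transitive_closure M \<subseteq> elts M"
      using tr unfolding transitive_set_def by (intro transitive_closure_subset) auto
    show "elts M \<lesssim> elts \<kappa>" unfolding M using lepoll_trans[OF image_lepoll card] .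
  qed
  moreover have "nontrivial_embedding (elts M) j"
    unfolding nontrivial_embedding_def using \<beta>M o\<beta> j\<beta> \<beta>(1) by (intro bexI[of _ \<beta>]) auto
  ultimately have "small_embedding \<kappa> \<theta> M j"
    unfolding small_embedding_def using tr ee crit j\<beta> by blast
  then show ?thesis using that jM crit by blast
qed

section \<open>The characterization of subtle cardinals\<close>

text \<open>
  The transitive closure is covered by \<open>\<kappa>\<close> and four sets for each index: the pair, its two members and
  the value of the list. The cover has cardinality at most \<open>\<kappa>\<close>.
\<close>

lemma vseq_in_Hset:
  assumes \<theta>: "cardinal \<theta>" "\<kappa> \<in> elts \<theta>" and \<kappa>: "ordinal \<kappa>" "infinite (elts \<kappa>)"
    and d: "is_list \<kappa> d"
  shows "vseq \<kappa> d \<in> Hset \<theta>"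
proof -
  define Q where "Q \<alpha> = {vpair \<alpha> (d \<alpha>), vset {\<alpha>}, vset {\<alpha>, d \<alpha>}, d \<alpha>}" for \<alpha>
  have d\<kappa>: "elts (d \<alpha>) \<subseteq> elts \<kappa>" if "\<alpha> \<in> elts \<kappa>" for \<alpha>
    using d that ordinal_mem_subset[OF \<kappa>(1)] unfolding is_list_def by blast
  have pair: "elts (vpair \<alpha> (d \<alpha>)) = {vset {\<alpha>}, vset {\<alpha>, d \<alpha>}}" for \<alpha>
    unfolding vpair_def by simp
  have seq: "elts (vseq \<kappa> d) = (\<lambda>\<alpha>. vpair \<alpha> (d \<alpha>)) ` elts \<kappa>"
    unfolding vseq_def by (intro elts_vset small_image small_elts)
  show ?thesis
  proof (rule HsetI[OF \<theta>])
    show "transitive_closure (vseq \<kappa> d) \<subseteq> (\<Union>\<alpha>\<in>elts \<kappa>. Q \<alpha>) \<union> elts \<kappa>"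
    proof (rule transitive_closure_subset)
      fix y assume "y \<in> (\<Union>\<alpha>\<in>elts \<kappa>. Q \<alpha>) \<union> elts \<kappa>"
      then consider "y \<in> elts \<kappa>" | \<alpha> where "\<alpha> \<in> elts \<kappa>" "y \<in> Q \<alpha>" by blast
      then show "elts y \<subseteq> (\<Union>\<alpha>\<in>elts \<kappa>. Q \<alpha>) \<union> elts \<kappa>"
      proof cases
        case 1
        then show ?thesis using ordinal_mem_subset[OF \<kappa>(1)] by blast
      next
        case 2
        have "elts y \<subseteq> insert \<alpha> (Q \<alpha> \<union> elts \<kappa>)"
          using 2(2) d\<kappa>[OF 2(1)] by (auto simp: Q_def pair)
        then show ?thesis using 2(1) by blast
      qed
    next
      show "elts (vseq \<kappa> d) \<subseteq> (\<Union>\<alpha>\<in>elts \<kappa>. Q \<alpha>) \<union> elts \<kappa>"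
        unfolding seq by (auto simp: Q_def)
    qed
    have "Q \<alpha> \<lesssim> elts \<kappa>" for \<alpha> by (rule finite_lepoll_infinite[OF \<kappa>(2)]) (simp add: Q_def)
    then show "(\<Union>\<alpha>\<in>elts \<kappa>. Q \<alpha>) \<union> elts \<kappa> \<lesssim> elts \<kappa>"
      by (intro infinite_Un_lepoll infinite_UN_lepoll \<kappa>(2) lepoll_refl)
  qed
qed

lemma subset_ordinal_in_Hset:
  assumes \<theta>: "cardinal \<theta>" "\<kappa> \<in> elts \<theta>" and \<kappa>: "ordinal \<kappa>" and x: "elts x \<subseteq> elts \<kappa>"
  shows "x \<in> Hset \<theta>"
  by (rule HsetI[OF \<theta> transitive_closure_subset[OF ordinal_mem_subset[OF \<kappa>] x] lepoll_refl])

lemma subtle_imp_small_embedding: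
  fixes \<kappa> :: "'v::zfc_universe"
  assumes sub: "subtle \<kappa>" and \<theta>: "cardinal \<theta>" "\<kappa> \<in> elts \<theta>"
    and d: "is_list \<kappa> d" and C: "club C \<kappa>"
  shows "\<exists>M j. small_embedding \<kappa> \<theta> M j \<and> vseq \<kappa> d \<in> j ` elts M \<and> C \<in> j ` elts M \<and>
    (\<exists>\<alpha> \<in> elts C \<inter> elts (crit (elts M) j).
       elts (d \<alpha>) = elts (d (crit (elts M) j)) \<inter> elts \<alpha>)"
proof -
  have unc: "uncountable (elts \<kappa>)" and reg: "regular_cardinal \<kappa>" using sub by (auto simp: subtle_def)
  then have \<kappa>: "ordinal \<kappa>" "infinite (elts \<kappa>)" by (auto simp: regular_cardinal_def cardinal_def)
  define P where "P = {vseq \<kappa> d, C, \<kappa>}"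
  define X where "X \<beta> = hull (skolem (Hset \<theta>)) (elts \<beta> \<union> P)" for \<beta>
  have C\<kappa>: "elts C \<subseteq> elts \<kappa>" using C by (simp add: club_def)
  have \<kappa>H: "\<kappa> \<in> Hset \<theta>" and CH: "C \<in> Hset \<theta>" using subset_ordinal_in_Hset[OF \<theta> \<kappa>(1)] C\<kappa> by blast+
  have PH: "P \<subseteq> Hset \<theta>" using vseq_in_Hset[OF \<theta> \<kappa> d] \<kappa>H CH by (simp add: P_def)
  have finP: "finite P" by (simp add: P_def)
  obtain D where D: "elts D = {\<beta> \<in> elts C. X \<beta> \<inter> elts \<kappa> \<subseteq> elts \<beta>}" "club D \<kappa>"
    using club_hull_closure_points[OF reg unc C finP, of "skolem (Hset \<theta>)", folded X_def] that
    by metis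
  obtain \<alpha> \<beta> where *: "\<alpha> \<in> elts D" "\<beta> \<in> elts D" "\<alpha> \<in> elts \<beta>" "elts (d \<alpha>) = elts (d \<beta>) \<inter> elts \<alpha>"
    using sub d D(2) unfolding subtle_def by blast
  have \<beta>: "\<beta> \<in> elts \<kappa>" using *(2) D(1) C\<kappa> by blast
  have \<beta>\<kappa>: "elts \<beta> \<subseteq> elts \<kappa>" using ordinal_mem_subset[OF \<kappa>(1) \<beta>] .
  have AH: "elts \<beta> \<union> P \<subseteq> Hset \<theta>" using \<beta>\<kappa> Hset_transitive[OF \<kappa>H] PH by blast
  have ne: "Hset \<theta> \<noteq> {}" using \<kappa>H by blast
  have base: "elts \<beta> \<union> P \<subseteq> X \<beta>" unfolding X_def by (intro subsetI hull.base)
  obtain M j where Mj: "small_embedding \<kappa> \<theta> M j" "j ` elts M = X \<beta>" "crit (elts M) j = \<beta>"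
  proof (rule small_embedding_of_elementary_substructure[OF \<theta> \<kappa>(1)])
    show "X \<beta> \<subseteq> Hset \<theta>"
      unfolding X_def using AH skolem(1)[OF ne] by (intro hull_subset) auto
    have "elts \<beta> \<union> P \<lesssim> elts \<kappa>"
      by (intro infinite_Un_lepoll \<kappa>(2) subset_imp_lepoll[OF \<beta>\<kappa>] finite_lepoll_infinite finP)
    then show "X \<beta> \<lesssim> elts \<kappa>" unfolding X_def by (rule hull_lepoll[OF \<kappa>(2)])
    show "sat (X \<beta>) \<phi> s \<longleftrightarrow> sat (Hset \<theta>) \<phi> s" if "range s \<subseteq> X \<beta>" for \<phi> s
      using sat_skolem_hull[OF ne AH] that unfolding X_def by blast
    show "\<beta> \<in> elts \<kappa>" by (rule \<beta>)
    show "\<kappa> \<in> X \<beta>" using base by (auto simp: P_def)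
    show "X \<beta> \<inter> elts \<kappa> = elts \<beta>" using base \<beta>\<kappa> *(2) D(1) by blast
  qed
  have "vseq \<kappa> d \<in> X \<beta>" "C \<in> X \<beta>" using base by (auto simp: P_def)
  moreover have "\<alpha> \<in> elts C" using *(1) D(1) by blast
  ultimately show ?thesis using Mj *(3,4) by (intro exI[of _ M] exI[of _ j]) auto
qed

text \<open>
  The two witnesses for the combinatorial clause are \<open>\<alpha>\<close> and the critical point, which lies in \<open>C\<close>.
  That argument needs \<open>\<kappa>\<close> to be a limit, so finite \<open>\<kappa>\<close> are excluded separately.
\<close>

lemma small_embeddings_imp_subtle:
  fixes \<kappa> :: "'v::zfc_universe"
  assumes \<kappa>: "cardinal \<kappa>"
    and ex: "\<And>d C. is_list \<kappa> d \<Longrightarrow> club C \<kappa> \<Longrightarrow>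
      \<exists>M j. small_embedding \<kappa> \<theta> M j \<and> C \<in> j ` elts M \<and>
        (\<exists>\<alpha> \<in> elts C \<inter> elts (crit (elts M) j).
           elts (d \<alpha>) = elts (d (crit (elts M) j)) \<inter> elts \<alpha>)"
  shows "subtle \<kappa>"
proof (rule subtleI[OF \<kappa>])
  have crit_mem: "crit (elts M) j \<in> elts \<kappa>" if "small_embedding \<kappa> \<theta> M j" for M j
    using that crit_properties(3)[of M j] unfolding small_embedding_def by simp
  show inf: "infinite (elts \<kappa>)"
  proof
    assume "finite (elts \<kappa>)"
    moreover have "ordinal \<kappa>" using \<kappa> by (simp add: cardinal_def)
    ultimately obtain C where C: "club C \<kappa>" "\<And>\<alpha> \<beta>. \<alpha> \<in> elts C \<Longrightarrow> \<beta> \<in> elts \<kappa> \<Longrightarrow> \<alpha> \<notin> elts \<beta>"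
      using finite_ordinal_club by blast
    have "is_list \<kappa> (\<lambda>\<alpha>. \<alpha>)" by (simp add: is_list_def)
    then obtain M j \<alpha> where "small_embedding \<kappa> \<theta> M j" "\<alpha> \<in> elts C" "\<alpha> \<in> elts (crit (elts M) j)"
      using ex[OF _ C(1)] by blast
    then show False using C(2) crit_mem by blast
  qed
  show "subtle_property \<kappa>"
    unfolding subtle_property_def
  proof (intro allI impI)
    fix d C assume "is_list \<kappa> d \<and> club C \<kappa>"
    then obtain M j \<alpha> where *: "small_embedding \<kappa> \<theta> M j" "C \<in> j ` elts M" "\<alpha> \<in> elts C"
        "\<alpha> \<in> elts (crit (elts M) j)" "elts (d \<alpha>) = elts (d (crit (elts M) j)) \<inter> elts \<alpha>"
      and C: "club C \<kappa>"
      using ex[of d C] by blast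
    have "crit (elts M) j \<in> elts C" using crit_mem_club[OF \<kappa> inf C *(1,2)] *(4) by blast
    then show "\<exists>\<alpha>\<in>elts C. \<exists>\<beta>\<in>elts C. \<alpha> \<in> elts \<beta> \<and> elts (d \<alpha>) = elts (d \<beta>) \<inter> elts \<alpha>"
      using * by blast
  qed
qed

theorem lemma5p2:
  fixes \<kappa> :: "'v::zfc_universe"
  assumes "cardinal \<kappa>"
  shows "subtle \<kappa> \<longleftrightarrow>
    (\<exists>\<alpha>\<^sub>0. ordinal \<alpha>\<^sub>0 \<and> elts \<kappa> \<subseteq> elts \<alpha>\<^sub>0 \<and>
      (\<forall>\<theta>. cardinal \<theta> \<and> \<alpha>\<^sub>0 \<in> elts \<theta> \<longrightarrow>
        (\<forall>d C. is_list \<kappa> d \<and> club C \<kappa> \<longrightarrow>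
          (\<exists>M j. small_embedding \<kappa> \<theta> M j \<and>
             vseq \<kappa> d \<in> j ` elts M \<and> C \<in> j ` elts M \<and>
             (\<exists>\<alpha> \<in> elts C \<inter> elts (crit (elts M) j).
                elts (d \<alpha>) = elts (d (crit (elts M) j)) \<inter> elts \<alpha>)))))"
proof (intro iffI; (elim exE conjE)?)
  assume sub: "subtle \<kappa>"
  have "ordinal \<kappa>" using assms by (simp add: cardinal_def)
  then show "\<exists>\<alpha>\<^sub>0. ordinal \<alpha>\<^sub>0 \<and> elts \<kappa> \<subseteq> elts \<alpha>\<^sub>0 \<and>
      (\<forall>\<theta>. cardinal \<theta> \<and> \<alpha>\<^sub>0 \<in> elts \<theta> \<longrightarrow>
        (\<forall>d C. is_list \<kappa> d \<and> club C \<kappa> \<longrightarrow>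
          (\<exists>M j. small_embedding \<kappa> \<theta> M j \<and>
             vseq \<kappa> d \<in> j ` elts M \<and> C \<in> j ` elts M \<and>
             (\<exists>\<alpha> \<in> elts C \<inter> elts (crit (elts M) j).
                elts (d \<alpha>) = elts (d (crit (elts M) j)) \<inter> elts \<alpha>))))"
    using subtle_imp_small_embedding[OF sub] by (intro exI[of _ \<kappa>] conjI subset_refl) auto
next
  fix \<alpha>\<^sub>0 assume "ordinal \<alpha>\<^sub>0" and "elts \<kappa> \<subseteq> elts \<alpha>\<^sub>0"
    and *: "\<forall>\<theta>. cardinal \<theta> \<and> \<alpha>\<^sub>0 \<in> elts \<theta> \<longrightarrow>
        (\<forall>d C. is_list \<kappa> d \<and> club C \<kappa> \<longrightarrow>
          (\<exists>M j. small_embedding \<kappa> \<theta> M j \<and>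
             vseq \<kappa> d \<in> j ` elts M \<and> C \<in> j ` elts M \<and>
             (\<exists>\<alpha> \<in> elts C \<inter> elts (crit (elts M) j).
                elts (d \<alpha>) = elts (d (crit (elts M) j)) \<inter> elts \<alpha>)))"
  from \<open>ordinal \<alpha>\<^sub>0\<close> obtain \<theta> where "cardinal \<theta>" "\<alpha>\<^sub>0 \<in> elts \<theta>" by (rule ex_cardinal_gt)
  with * show "subtle \<kappa>" by (intro small_embeddings_imp_subtle[OF assms, of \<theta>]) meson
qed

end
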